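(* Let $M\subset\mathbb{C}^n$ be a smooth real hypersurface and $p\in M$. There exists a unique cubic tensor (multilinear map) $$\tau^3_p\colon\mathbb{C}T_p\times K^{10}_p\times\overline{K^{10}_p}\to\mathbb{C}Q_p$$ satisfying $$\langle\theta_p,\tau^3_p(L^3_p,L^2_p,L^1_p)\rangle=i\,(L^3\langle\theta,[L^2,L^1]\rangle)_p$$ for every contact form $\theta$, every $L^3\in\mathbb{C}T$, and all $L^2,\overline{L^1}\in H^{10}$ with $L^2_p,\overline{L^1_p}\in K^{10}_p$. Furthermore, $\tau^3_p$ satisfies the reality condition $$\overline{\tau^3_p(v^3,v^2,v^1)}=\tau^3_p(\overline{v^3},\overline{v^1},\overline{v^2}).$$
   Context: Everything is $C^\infty$. $T=TM$; $H\subset T$ is the complex tangent bundle; $Q=T/H$; $\mathbb{C}T,\mathbb{C}H,\mathbb{C}Q$ are complexifications; $\mathbb{C}H=H^{10}\oplus\overline{H^{10}}$ is the decomposition into $(1,0)$ and $(0,1)$ vectors. "$L\in V$" means $L$ is a local section of $V$ near $p$. A contact form is a real $1$-form on $M$ vanishing on $H$; it pairs with $\mathbb{C}Q$ via $\langle\theta,\cdot\rangle$. The Levi form is the bilinear map $\tau^2_p\colon H^{10}_p\times\overline{H^{10}_p}\to\mathbb{C}Q_p$ with $\langle\theta_p,\tau^2_p(L^2_p,L^1_p)\rangle=i\langle\theta,[L^2,L^1]\rangle_p$ for $L^2\in H^{10}$, $L^1\in\overline{H^{10}}$ and all contact forms $\theta$. The Levi kernel is $K^{10}_p=\{v\in H^{10}_p:\tau^2_p(v,\bar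 u)=0\ \forall u\in H^{10}_p\}$. *)

theory Defs
  imports "HOL-Analysis.Analysis"
begin

section \<open>Smoothness\<close>

text \<open>Meant for open subsets of a Euclidean space, where existence and continuity of all iterated
  directional derivatives up to order \<open>k\<close>, together with Frechet differentiability of those of order
  less than \<open>k\<close>, is the usual notion of class \<open>C\<^sup>k\<close>.\<close>

primrec Ck_on :: "nat \<Rightarrow> 'a::euclidean_space set \<Rightarrow> ('a \<Rightarrow> 'b::real_normed_vector) \<Rightarrow> bool" where
  "Ck_on 0 S f \<longleftrightarrow> continuous_on S f"
| "Ck_on (Suc k) S f \<longleftrightarrow>
     (\<forall>x\<in>S. f differentiable (at x)) \<and> (\<forall>v. Ck_on k S (\<lambda>x. frechet_derivative f (at x) v))"

definition smooth_on :: "'a::euclidean_space set \<Rightarrow> ('a \<Rightarrow> 'b::real_normed_vector) \<Rightarrow> bool" where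
  "smooth_on S f \<longleftrightarrow> (\<forall>k. Ck_on k S f)"

text \<open>Smoothness on an arbitrary set (in use: a relatively open part of a hypersurface), i.e.
  existence of smooth extensions locally around each point.\<close>

definition smooth_map_on :: "'a::euclidean_space set \<Rightarrow> ('a \<Rightarrow> 'b::real_normed_vector) \<Rightarrow> bool" where
  "smooth_map_on S f \<longleftrightarrow>
     (\<forall>x\<in>S. \<exists>U g. open U \<and> x \<in> U \<and> smooth_on U g \<and> (\<forall>y\<in>S \<inter> U. g y = f y))"


section \<open>Real hypersurfaces and their tangent spaces\<close>

definition smooth_real_hypersurface :: "(complex ^ 'n) set \<Rightarrow> bool" where
  "smooth_real_hypersurface M \<longleftrightarrow>
     (\<forall>q\<in>M. \<exists>U (\<rho> :: complex ^ 'n \<Rightarrow> real). open U \<and> q \<in> U \<and> smooth_on U \<rho> \<and>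
        M \<inter> U = {x \<in> U. \<rho> x = 0} \<and>
        (\<forall>x\<in>M \<inter> U. \<exists>v. frechet_derivative \<rho> (at x) v \<noteq> 0))"

text \<open>Velocities of curves in \<open>M\<close>. On a smooth hypersurface, differentiability of the curve at
  time 0 already yields exactly the velocities of smooth curves.\<close>

definition tangent_space :: "(complex ^ 'n) set \<Rightarrow> complex ^ 'n \<Rightarrow> (complex ^ 'n) set" where
  "tangent_space M q =
     {v. \<exists>(\<gamma> :: real \<Rightarrow> complex ^ 'n) \<epsilon>. \<epsilon> > 0 \<and> \<gamma> 0 = q \<and> (\<forall>t\<in>{-\<epsilon><..<\<epsilon>}. \<gamma> t \<in> M) \<and>
            (\<gamma> has_vector_derivative v) (at 0)}"

definition complex_tangent_space :: "(complex ^ 'n) set \<Rightarrow> complex ^ 'n \<Rightarrow> (complex ^ 'n) set" where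
  "complex_tangent_space M q = {v \<in> tangent_space M q. \<i> *s v \<in> tangent_space M q}"


section \<open>Complexification\<close>

text \<open>The pair \<open>(X, Y)\<close> encodes \<open>X + iY\<close> in the complexification of a real vector space. If that
  space is \<open>complex ^ 'n\<close>, this formal \<open>i\<close> (acting by \<open>cscale\<close>) must not be confused with the complex
  structure \<open>v \<mapsto> \<i> *s v\<close>, whose complex-linear extension is \<open>cplx_J\<close>.\<close>

type_synonym 'a cplx = "'a \<times> 'a"

definition cscale :: "complex \<Rightarrow> 'a::real_vector cplx \<Rightarrow> 'a cplx" where
  "cscale c v = (Re c *\<^sub>R fst v - Im c *\<^sub>R snd v, Re c *\<^sub>R snd v + Im c *\<^sub>R fst v)"

definition cconj :: "'a::real_vector cplx \<Rightarrow> 'a cplx" where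
  "cconj v = (fst v, - snd v)"

definition cplx_J :: "(complex ^ 'n) cplx \<Rightarrow> (complex ^ 'n) cplx" where
  "cplx_J v = (\<i> *s fst v, \<i> *s snd v)"

definition CT :: "(complex ^ 'n) set \<Rightarrow> complex ^ 'n \<Rightarrow> (complex ^ 'n) cplx set" where
  "CT M q = tangent_space M q \<times> tangent_space M q"

definition CH :: "(complex ^ 'n) set \<Rightarrow> complex ^ 'n \<Rightarrow> (complex ^ 'n) cplx set" where
  "CH M q = complex_tangent_space M q \<times> complex_tangent_space M q"

definition H10 :: "(complex ^ 'n) set \<Rightarrow> complex ^ 'n \<Rightarrow> (complex ^ 'n) cplx set" where
  "H10 M q = {v \<in> CH M q. cplx_J v = cscale \<i> v}"

definition H10_bar :: "(complex ^ 'n) set \<Rightarrow> complex ^ 'n \<Rightarrow> (complex ^ 'n) cplx set" where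
  "H10_bar M q = cconj ` H10 M q"


section \<open>The quotient bundle\<close>

text \<open>\<open>CQ M q\<close> is the quotient of \<open>CT M q\<close> by \<open>CH M q\<close>, identified with the complexification of the
  real quotient; its elements are cosets, and the zero element is \<open>CH M q\<close> itself. In \<open>cq_scale\<close> the
  summand \<open>h\<close> only matters for \<open>c = 0\<close>.\<close>

definition CQ :: "(complex ^ 'n) set \<Rightarrow> complex ^ 'n \<Rightarrow> (complex ^ 'n) cplx set set" where
  "CQ M q = {{v + h |h. h \<in> CH M q} |v. v \<in> CT M q}"

definition cq_plus :: "(complex ^ 'n) cplx set \<Rightarrow> (complex ^ 'n) cplx set \<Rightarrow> (complex ^ 'n) cplx set" where
  "cq_plus A B = {a + b |a b. a \<in> A \<and> b \<in> B}"

definition cq_scale :: "(complex ^ 'n) set \<Rightarrow> complex ^ 'n \<Rightarrow> complex \<Rightarrow>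
    (complex ^ 'n) cplx set \<Rightarrow> (complex ^ 'n) cplx set" where
  "cq_scale M q c A = {cscale c a + h |a h. a \<in> A \<and> h \<in> CH M q}"

definition cq_conj :: "(complex ^ 'n) cplx set \<Rightarrow> (complex ^ 'n) cplx set" where
  "cq_conj A = cconj ` A"

definition clinear_on_CQ :: "(complex ^ 'n) set \<Rightarrow> complex ^ 'n \<Rightarrow> (complex ^ 'n) cplx set \<Rightarrow>
    ((complex ^ 'n) cplx \<Rightarrow> (complex ^ 'n) cplx set) \<Rightarrow> bool" where
  "clinear_on_CQ M q V f \<longleftrightarrow>
     (\<forall>u\<in>V. \<forall>v\<in>V. \<forall>a b. f (cscale a u + cscale b v) =
        cq_plus (cq_scale M q a (f u)) (cq_scale M q b (f v)))"


section \<open>Contact forms\<close>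

text \<open>A 1-form on \<open>M\<close> is represented by a smooth field \<open>\<theta>\<close> of real covectors of the ambient space,
  defined along \<open>M\<close>; only the restriction of \<open>\<theta> q\<close> to the tangent space at \<open>q\<close> is ever used, and every
  smooth 1-form on \<open>M\<close> arises this way.\<close>

definition contact_form :: "(complex ^ 'n) set \<Rightarrow> (complex ^ 'n \<Rightarrow> complex ^ 'n \<Rightarrow> real) \<Rightarrow> bool" where
  "contact_form M \<theta> \<longleftrightarrow>
     (\<forall>q\<in>M. linear (\<theta> q)) \<and>
     (\<forall>v. smooth_map_on M (\<lambda>q. \<theta> q v)) \<and>
     (\<forall>q\<in>M. \<forall>v\<in>complex_tangent_space M q. \<theta> q v = 0)"

definition cpair :: "('a \<Rightarrow> real) \<Rightarrow> 'a cplx \<Rightarrow> complex" where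
  "cpair \<alpha> v = Complex (\<alpha> (fst v)) (\<alpha> (snd v))"

text \<open>The induced pairing with \<open>CQ\<close>: the common value on all representatives of a coset.\<close>

definition cq_pair :: "('a \<Rightarrow> real) \<Rightarrow> 'a cplx set \<Rightarrow> complex" where
  "cq_pair \<alpha> A = (THE z. \<forall>a\<in>A. cpair \<alpha> a = z)"


section \<open>Local sections and brackets\<close>

definition local_section :: "(complex ^ 'n) set \<Rightarrow> complex ^ 'n \<Rightarrow>
    (complex ^ 'n \<Rightarrow> (complex ^ 'n) cplx set) \<Rightarrow> (complex ^ 'n \<Rightarrow> (complex ^ 'n) cplx) \<Rightarrow> bool" where
  "local_section M p V L \<longleftrightarrow>
     (\<exists>U. open U \<and> p \<in> U \<and> smooth_map_on (M \<inter> U) L \<and> (\<forall>q\<in>M \<inter> U. L q \<in> V q))"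

text \<open>Derivatives of functions on \<open>M\<close> in the direction of \<open>v = X + iY\<close> with \<open>X\<close>, \<open>Y\<close> tangent to \<open>M\<close>. A
  derivative at \<open>q\<close> within \<open>M\<close> is not unique as a linear map on the ambient space, but all such
  derivatives agree on tangent vectors (chain rule along curves in \<open>M\<close>).\<close>

definition deriv_fun :: "(complex ^ 'n) set \<Rightarrow> (complex ^ 'n) cplx \<Rightarrow>
    (complex ^ 'n \<Rightarrow> complex) \<Rightarrow> complex ^ 'n \<Rightarrow> complex" where
  "deriv_fun M v f q =
     frechet_derivative f (at q within M) (fst v) + \<i> * frechet_derivative f (at q within M) (snd v)"

definition deriv_field :: "(complex ^ 'n) set \<Rightarrow> (complex ^ 'n) cplx \<Rightarrow>
    (complex ^ 'n \<Rightarrow> (complex ^ 'n) cplx) \<Rightarrow> complex ^ 'n \<Rightarrow> (complex ^ 'n) cplx" where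
  "deriv_field M v L q =
     frechet_derivative L (at q within M) (fst v) +
     cscale \<i> (frechet_derivative L (at q within M) (snd v))"

text \<open>The Lie bracket of complex vector fields on \<open>M\<close>, in the coordinates of the ambient space.\<close>

definition lie_bracket :: "(complex ^ 'n) set \<Rightarrow> (complex ^ 'n \<Rightarrow> (complex ^ 'n) cplx) \<Rightarrow>
    (complex ^ 'n \<Rightarrow> (complex ^ 'n) cplx) \<Rightarrow> complex ^ 'n \<Rightarrow> (complex ^ 'n) cplx" where
  "lie_bracket M L L' q = deriv_field M (L q) L' q - deriv_field M (L' q) L q"


section \<open>Levi form, Levi kernel and cubic tensor\<close>

definition is_levi_form :: "(complex ^ 'n) set \<Rightarrow> complex ^ 'n \<Rightarrow>
    ((complex ^ 'n) cplx \<times> (complex ^ 'n) cplx \<Rightarrow> (complex ^ 'n) cplx set) \<Rightarrow> bool" where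
  "is_levi_form M p \<tau> \<longleftrightarrow>
     \<tau> \<in> (H10 M p \<times> H10_bar M p) \<rightarrow>\<^sub>E CQ M p \<and>
     (\<forall>w\<in>H10_bar M p. clinear_on_CQ M p (H10 M p) (\<lambda>v. \<tau> (v, w))) \<and>
     (\<forall>v\<in>H10 M p. clinear_on_CQ M p (H10_bar M p) (\<lambda>w. \<tau> (v, w))) \<and>
     (\<forall>\<theta> L2 L1. contact_form M \<theta> \<and> local_section M p (H10 M) L2 \<and> local_section M p (H10_bar M) L1 \<longrightarrow>
        cq_pair (\<theta> p) (\<tau> (L2 p, L1 p)) = \<i> * cpair (\<theta> p) (lie_bracket M L2 L1 p))"

definition levi_form :: "(complex ^ 'n) set \<Rightarrow> complex ^ 'n \<Rightarrow>
    (complex ^ 'n) cplx \<times> (complex ^ 'n) cplx \<Rightarrow> (complex ^ 'n) cplx set" where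
  "levi_form M p = (THE \<tau>. is_levi_form M p \<tau>)"

definition K10 :: "(complex ^ 'n) set \<Rightarrow> complex ^ 'n \<Rightarrow> (complex ^ 'n) cplx set" where
  "K10 M p = {v \<in> H10 M p. \<forall>u\<in>H10 M p. levi_form M p (v, cconj u) = CH M p}"

definition K10_bar :: "(complex ^ 'n) set \<Rightarrow> complex ^ 'n \<Rightarrow> (complex ^ 'n) cplx set" where
  "K10_bar M p = cconj ` K10 M p"

definition is_cubic_tensor :: "(complex ^ 'n) set \<Rightarrow> complex ^ 'n \<Rightarrow>
    ((complex ^ 'n) cplx \<times> (complex ^ 'n) cplx \<times> (complex ^ 'n) cplx \<Rightarrow> (complex ^ 'n) cplx set) \<Rightarrow> bool"
  where
  "is_cubic_tensor M p \<tau> \<longleftrightarrow>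
     \<tau> \<in> (CT M p \<times> K10 M p \<times> K10_bar M p) \<rightarrow>\<^sub>E CQ M p \<and>
     (\<forall>v2\<in>K10 M p. \<forall>v1\<in>K10_bar M p. clinear_on_CQ M p (CT M p) (\<lambda>v3. \<tau> (v3, v2, v1))) \<and>
     (\<forall>v3\<in>CT M p. \<forall>v1\<in>K10_bar M p. clinear_on_CQ M p (K10 M p) (\<lambda>v2. \<tau> (v3, v2, v1))) \<and>
     (\<forall>v3\<in>CT M p. \<forall>v2\<in>K10 M p. clinear_on_CQ M p (K10_bar M p) (\<lambda>v1. \<tau> (v3, v2, v1)))"

definition satisfies_cubic_identity :: "(complex ^ 'n) set \<Rightarrow> complex ^ 'n \<Rightarrow>
    ((complex ^ 'n) cplx \<times> (complex ^ 'n) cplx \<times> (complex ^ 'n) cplx \<Rightarrow> (complex ^ 'n) cplx set) \<Rightarrow> bool"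
  where
  "satisfies_cubic_identity M p \<tau> \<longleftrightarrow>
     (\<forall>\<theta> L3 L2 L1.
        contact_form M \<theta> \<and> local_section M p (CT M) L3 \<and>
        local_section M p (H10 M) L2 \<and> local_section M p (H10 M) (\<lambda>q. cconj (L1 q)) \<and>
        L2 p \<in> K10 M p \<and> cconj (L1 p) \<in> K10 M p \<longrightarrow>
        cq_pair (\<theta> p) (\<tau> (L3 p, L2 p, L1 p)) =
          \<i> * deriv_fun M (L3 p) (\<lambda>q. cpair (\<theta> q) (lie_bracket M L2 L1 q)) p)"

end

theory Submission
  imports Defs
begin

text \<open>Near \<open>p\<close> let \<open>\<rho>\<close> be a defining function and \<open>J\<close> the complex structure of the ambient space. Then \<open>T\<close> is
the kernel of \<open>d\<rho>\<close>, \<open>H\<close> is the common kernel of \<open>d\<rho>\<close> and \<open>\<alpha> = d\<rho> \<circ> J\<close>, and on \<open>T\<close> every contact form is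
a multiple \<open>\<theta> = \<kappa> \<alpha>\<close> with a differentiable function \<open>\<kappa>\<close>. Differentiating the relations \<open>d\<rho> (L) = 0\<close> and
\<open>\<alpha> (L) = 0\<close> that hold along \<open>M\<close> for sections of \<open>H\<close> shows (\<open>lie_bracket_CH\<close>) that
\<open>\<langle>\<alpha>, [L\<^sup>2, L\<^sup>1]\<rangle> = B (L\<^sup>2, L\<^sup>1)\<close>, where \<open>B\<close> is a bilinear form at each point whose coefficients are
second derivatives of \<open>\<rho>\<close>. It represents the Levi form up to the factor \<open>i\<close>, it is antisymmetric, and
it commutes with conjugation.

Therefore \<open>L\<^sup>3 \<langle>\<theta>, [L\<^sup>2, L\<^sup>1]\<rangle> = (L\<^sup>3 \<kappa>) B (L\<^sup>2, L\<^sup>1) + \<kappa> L\<^sup>3 (B (L\<^sup>2, L\<^sup>1))\<close>, and at \<open>p\<close> the first term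
vanishes if \<open>L\<^sup>2\<close> has its value in the Levi kernel. The second term depends on the values at \<open>p\<close> only:
two sections of \<open>H10\<close> with the same value at \<open>p\<close> have a difference that vanishes at \<open>p\<close>, so the derivative
of this difference in a direction tangent to \<open>M\<close> belongs again to \<open>H10\<close>
(\<open>section_derivative_difference\<close>), and \<open>B\<close> of it against a vector of the conjugate
kernel is zero; the same holds with the roles of \<open>L\<^sup>2\<close> and \<open>L\<^sup>1\<close> exchanged
(\<open>levi_along_sections_derivative\<close>). It follows that \<open>\<tau>\<^sup>3\<close> can be computed on any convenient
extensions of the given vectors; with extensions that depend linearly on the vectors and commute with
conjugation, its trilinearity is evident and its reality follows from antisymmetry and reality of \<open>B\<close>.

Uniqueness holds since all vectors extend to sections, the quotient of \<open>T\<close> by \<open>H\<close> is a line, and some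
contact form on \<open>M\<close> is nonzero at \<open>p\<close> (\<open>contact_form_exists\<close>).\<close>

section \<open>Derivatives along a subset\<close>

text \<open>A derivative within \<open>M\<close> is unique only on tangent vectors: composed with a curve in \<open>M\<close> of velocity
\<open>v\<close> it becomes an ordinary derivative in one variable. The choice made by \<open>frechet_derivative\<close>
is therefore harmless in every tangential direction.\<close>

lemma tangential_derivative:
  fixes M :: "(complex ^ 'n) set" and f :: "complex ^ 'n \<Rightarrow> 'b::real_normed_vector"
  assumes f: "(f has_derivative f') (at q within M)" and v: "v \<in> tangent_space M q"
  shows "frechet_derivative f (at q within M) v = f' v"
proof -
  obtain \<gamma> \<epsilon> where \<epsilon>: "\<epsilon> > 0" and \<gamma>0: "\<gamma> 0 = q" and \<gamma>M: "\<And>t. t \<in> {-\<epsilon><..<\<epsilon>} \<Longrightarrow> \<gamma> t \<in> M"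
    and \<gamma>v: "(\<gamma> has_vector_derivative v) (at (0::real))"
    using v unfolding tangent_space_def by blast
  have D: "((\<lambda>t. f (\<gamma> t)) has_derivative (\<lambda>t. F (t *\<^sub>R v))) (at 0)"
    if F: "(f has_derivative F) (at q within M)" for F
  proof -
    have "((f \<circ> \<gamma>) has_derivative (F \<circ> (\<lambda>t. t *\<^sub>R v))) (at 0 within {-\<epsilon><..<\<epsilon>})"
    proof (rule diff_chain_within)
      show "(\<gamma> has_derivative (\<lambda>t. t *\<^sub>R v)) (at 0 within {-\<epsilon><..<\<epsilon>})"
        using \<gamma>v unfolding has_vector_derivative_def by (rule has_derivative_at_withinI)
      show "(f has_derivative F) (at (\<gamma> 0) within \<gamma> ` {-\<epsilon><..<\<epsilon>})"
        using F \<gamma>M unfolding \<gamma>0 by (blast intro: has_derivative_subset)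
    qed
    then show ?thesis
      using \<epsilon> at_within_open[of 0 "{-\<epsilon><..<\<epsilon>}"] by (simp add: o_def)
  qed
  have "(f has_derivative frechet_derivative f (at q within M)) (at q within M)"
    using f frechet_derivative_works differentiable_def by blast
  from has_derivative_unique[OF D[OF this] D[OF f]]
  show ?thesis by (metis scaleR_one)
qed

lemma tangential_derivative_unique:
  fixes M :: "(complex ^ 'n) set" and f g :: "complex ^ 'n \<Rightarrow> 'b::real_normed_vector"
  assumes f: "(f has_derivative f') (at q within M)" and g: "(g has_derivative g') (at q within M)"
    and V: "open V" "q \<in> V" "q \<in> M" "\<And>x. x \<in> M \<inter> V \<Longrightarrow> f x = g x"
    and h: "h \<in> tangent_space M q"
  shows "f' h = g' h"
proof -
  have "(g has_derivative f') (at q within M)"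
    by (rule has_derivative_transform_eventually[OF f])
       (use V in \<open>auto simp: eventually_at_topological intro!: exI[of _ V]\<close>)
  from tangential_derivative[OF this h] tangential_derivative[OF g h] show ?thesis by simp
qed

section \<open>Smooth functions\<close>

abbreviation dd :: "('a::real_normed_vector \<Rightarrow> 'b::real_normed_vector) \<Rightarrow> 'a \<Rightarrow> 'a \<Rightarrow> 'b" where
  "dd f v \<equiv> \<lambda>x. frechet_derivative f (at x) v"

lemma Ck_on_cong:
  assumes "open S" "\<And>x. x \<in> S \<Longrightarrow> f x = g x" "Ck_on k S f"
  shows "Ck_on k S g"
  using assms(2,3)
proof (induction k arbitrary: f g)
  case 0
  then show ?case by (simp cong: continuous_on_cong)
next
  case (Suc k)
  have d: "f differentiable (at x)" if "x \<in> S" for x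
    using Suc.prems that by simp
  have "frechet_derivative f (at x) = frechet_derivative g (at x)" if "x \<in> S" for x
    using frechet_derivative_transform_within_open[OF d[OF that] \<open>open S\<close> that] Suc.prems(1) by blast
  moreover have "g differentiable (at x)" if "x \<in> S" for x
    using d[OF that] Suc.prems(1) \<open>open S\<close> that unfolding differentiable_def
    by (meson has_derivative_transform_within_open)
  ultimately show ?case
    using Suc.prems(2) by (auto intro!: Suc.IH[of "dd f _" "dd g _"])
qed

text \<open>Lets inductions on the order of differentiability run on an explicit derivative.\<close>

lemma Ck_on_SucI:
  assumes "open S" "\<And>x. x \<in> S \<Longrightarrow> (f has_derivative f' x) (at x)" "\<And>v. Ck_on k S (\<lambda>x. f' x v)"
  shows "Ck_on (Suc k) S f"
proof -
  have "Ck_on k S (dd f v)" for v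
    by (rule Ck_on_cong[OF assms(1) _ assms(3)[of v]])
       (use assms(2) frechet_derivative_at in metis)
  then show ?thesis
    using assms(2) by (auto simp: differentiable_def)
qed

lemma Ck_on_Suc_imp: "Ck_on (Suc k) S f \<Longrightarrow> Ck_on k S f"
proof (induction k arbitrary: f)
  case 0
  then show ?case
    by (auto intro!: differentiable_imp_continuous_on differentiable_at_imp_differentiable_on)
next
  case (Suc k)
  then show ?case by (metis Ck_on.simps(2))
qed

lemma Ck_on_bounded_linear:
  assumes "open S" "bounded_linear h" "Ck_on k S f"
  shows "Ck_on k S (\<lambda>x. h (f x))"
  using assms(3)
proof (induction k arbitrary: f)
  case 0
  then show ?case unfolding Ck_on.simps by (rule bounded_linear.continuous_on[OF assms(2)])
next
  case (Suc k)
  show ?case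
  proof (rule Ck_on_SucI[OF assms(1)])
    show "((\<lambda>x. h (f x)) has_derivative (\<lambda>v. h (dd f v x))) (at x)" if "x \<in> S" for x
      using Suc.prems that
      by (intro bounded_linear.has_derivative[OF assms(2)]) (auto simp: frechet_derivative_works)
    show "Ck_on k S (\<lambda>x. h (dd f v x))" for v
      using Suc by simp
  qed
qed

lemma Ck_on_add:
  assumes "open S" "Ck_on k S f" "Ck_on k S g"
  shows "Ck_on k S (\<lambda>x. f x + g x)"
  using assms(2,3)
proof (induction k arbitrary: f g)
  case 0
  then show ?case by (simp add: continuous_on_add)
next
  case (Suc k)
  show ?case
  proof (rule Ck_on_SucI[OF assms(1)])
    show "((\<lambda>x. f x + g x) has_derivative (\<lambda>v. dd f v x + dd g v x)) (at x)" if "x \<in> S" for x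
      using Suc.prems that
      by (intro has_derivative_add) (auto simp: frechet_derivative_works)
    show "Ck_on k S (\<lambda>x. dd f v x + dd g v x)" for v
      using Suc by simp
  qed
qed

text \<open>By the Leibniz rule the derivative is a sum of products of the same shape, so the induction never
meets a higher-order product formula.\<close>

lemma Ck_on_bounded_bilinear:
  assumes "open S" "bounded_bilinear h" "Ck_on k S f" "Ck_on k S g"
  shows "Ck_on k S (\<lambda>x. h (f x) (g x))"
  using assms(3,4)
proof (induction k arbitrary: f g)
  case 0
  then show ?case unfolding Ck_on.simps by (rule bounded_bilinear.continuous_on[OF assms(2)])
next
  case (Suc k)
  note fg = Ck_on_Suc_imp[OF Suc.prems(1)] Ck_on_Suc_imp[OF Suc.prems(2)]
  show ?case
  proof (rule Ck_on_SucI[OF assms(1)])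
    show "((\<lambda>x. h (f x) (g x)) has_derivative (\<lambda>v. h (f x) (dd g v x) + h (dd f v x) (g x))) (at x)"
      if "x \<in> S" for x
      using Suc.prems that
      by (intro bounded_bilinear.FDERIV[OF assms(2)]) (auto simp: frechet_derivative_works)
    show "Ck_on k S (\<lambda>x. h (f x) (dd g v x) + h (dd f v x) (g x))" for v
      using Suc.prems Suc.IH fg by (intro Ck_on_add[OF assms(1)]) auto
  qed
qed

lemma Ck_on_const: "Ck_on k S (\<lambda>x. c)"
  by (induction k arbitrary: c) auto

lemma smooth_on_const: "smooth_on S (\<lambda>x. c)"
  by (simp add: smooth_on_def Ck_on_const)

lemma smooth_on_id: "open S \<Longrightarrow> smooth_on S (\<lambda>x. x)"
  unfolding smooth_on_def
proof
  fix k assume "open S"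
  show "Ck_on k S (\<lambda>x. x)"
  proof (cases k)
    case (Suc l)
    then show ?thesis
      using Ck_on_SucI[OF \<open>open S\<close>, of "\<lambda>x. x" "\<lambda>x v. v" l] Ck_on_const by (auto simp: has_derivative_ident)
  qed simp
qed

lemma smooth_on_add: "open S \<Longrightarrow> smooth_on S f \<Longrightarrow> smooth_on S g \<Longrightarrow> smooth_on S (\<lambda>x. f x + g x)"
  by (simp add: smooth_on_def Ck_on_add)

lemma smooth_on_bounded_linear:
  "open S \<Longrightarrow> bounded_linear h \<Longrightarrow> smooth_on S f \<Longrightarrow> smooth_on S (\<lambda>x. h (f x))"
  by (simp add: smooth_on_def Ck_on_bounded_linear)

lemma smooth_on_bounded_bilinear:
  "open S \<Longrightarrow> bounded_bilinear h \<Longrightarrow> smooth_on S f \<Longrightarrow> smooth_on S g \<Longrightarrow> smooth_on S (\<lambda>x. h (f x) (g x))"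
  by (simp add: smooth_on_def Ck_on_bounded_bilinear)

lemma smooth_on_diff:
  "open S \<Longrightarrow> smooth_on S f \<Longrightarrow> smooth_on S g \<Longrightarrow> smooth_on S (\<lambda>x. f x - g x)"
  using smooth_on_add[of S f "\<lambda>x. - g x"] smooth_on_bounded_linear[OF _ bounded_linear_minus[OF bounded_linear_ident], of S g]
  by simp

lemmas smooth_on_mult = smooth_on_bounded_bilinear[OF _ bounded_bilinear_mult]
lemmas smooth_on_scaleR = smooth_on_bounded_bilinear[OF _ bounded_bilinear_scaleR]

lemma smooth_on_Pair:
  assumes "open S" "smooth_on S f" "smooth_on S g"
  shows "smooth_on S (\<lambda>x. (f x, g x))"
proof -
  have "smooth_on S (\<lambda>x. (f x, 0) + (0, g x))"
    using assms
    by (intro smooth_on_add smooth_on_bounded_linear[of S "\<lambda>y. (y, 0)"]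
        smooth_on_bounded_linear[of S "\<lambda>y. (0, y)"])
       (auto intro: bounded_linear_Pair bounded_linear_ident bounded_linear_zero)
  then show ?thesis by simp
qed

lemma smooth_on_dd: "smooth_on S f \<Longrightarrow> smooth_on S (dd f v)"
  unfolding smooth_on_def by (metis Ck_on.simps(2))

lemma smooth_on_has_derivative:
  "smooth_on S f \<Longrightarrow> x \<in> S \<Longrightarrow> (f has_derivative (\<lambda>v. dd f v x)) (at x)"
  unfolding smooth_on_def by (metis Ck_on.simps(2) frechet_derivative_works)

lemma smooth_on_continuous: "smooth_on S f \<Longrightarrow> continuous_on S f"
  unfolding smooth_on_def by (metis Ck_on.simps(1))

lemma smooth_on_subset:
  assumes "smooth_on S f" "T \<subseteq> S"
  shows "smooth_on T f"
proof -
  have "Ck_on k S f \<Longrightarrow> Ck_on k T f" for k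
    using assms(2) by (induction k arbitrary: f) (auto intro: continuous_on_subset)
  then show ?thesis using assms by (auto simp: smooth_on_def)
qed

lemma smooth_map_on_differentiable:
  assumes "smooth_map_on S f" "x \<in> S"
  shows "f differentiable (at x within S)"
proof -
  obtain U g where U: "open U" "x \<in> U" "smooth_on U g" "\<forall>y\<in>S \<inter> U. g y = f y"
    using assms unfolding smooth_map_on_def by blast
  have "(g has_derivative (\<lambda>v. dd g v x)) (at x within S)"
    using smooth_on_has_derivative[OF U(3,2)] by (rule has_derivative_at_withinI)
  then have "(f has_derivative (\<lambda>v. dd g v x)) (at x within S)"
    by (rule has_derivative_transform_eventually)
       (use U assms(2) in \<open>auto simp: eventually_at_topological intro!: exI[of _ U]\<close>)
  then show ?thesis by (auto simp: differentiable_def)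
qed

section \<open>A smooth bump function\<close>

text \<open>The factor \<open>P(1/t)\<close> makes this family of functions, flat at \<open>0\<close>, closed under differentiation, so
that smoothness can be proved by induction on the order for all \<open>P\<close> at once.\<close>

definition flat_exp :: "real poly \<Rightarrow> real \<Rightarrow> real" where
  "flat_exp P t = (if t > 0 then poly P (inverse t) * exp (- inverse t) else 0)"

lemma poly_times_exp_minus_tendsto_0: "((\<lambda>y. poly P y * exp (- y)) \<longlongrightarrow> (0::real)) at_top"
proof -
  have "((\<lambda>y. \<Sum>i\<le>degree P. coeff P i * (y ^ i / exp y)) \<longlongrightarrow> (\<Sum>i\<le>degree P. coeff P i * 0)) at_top"
    by (intro tendsto_intros tendsto_power_div_exp_0)
  then show ?thesis
    by (simp add: poly_altdef exp_minus field_simps sum_distrib_left sum_divide_distrib)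
qed

lemma flat_exp_has_real_derivative:
  "(flat_exp P has_real_derivative flat_exp (monom 1 2 * (P - pderiv P)) t) (at t)"
proof -
  consider "t > 0" | "t < 0" | "t = 0" by linarith
  then show ?thesis
  proof cases
    case 1
    have "((\<lambda>t. poly P (inverse t) * exp (- inverse t)) has_real_derivative
        flat_exp (monom 1 2 * (P - pderiv P)) t) (at t)"
      using 1 unfolding flat_exp_def
      by (auto intro!: derivative_eq_intros simp: poly_monom power2_eq_square algebra_simps)
    then show ?thesis
      by (rule DERIV_cong_ev[THEN iffD1, rotated 3])
         (use 1 in \<open>auto simp: flat_exp_def eventually_nhds intro!: exI[of _ "{0<..}"]\<close>)
  next
    case 2
    have "((\<lambda>t. 0) has_real_derivative flat_exp (monom 1 2 * (P - pderiv P)) t) (at t)"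
      using 2 unfolding flat_exp_def by simp
    then show ?thesis
      by (rule DERIV_cong_ev[THEN iffD1, rotated 3])
         (use 2 in \<open>auto simp: flat_exp_def eventually_nhds intro!: exI[of _ "{..<0}"]\<close>)
  next
    case 3
    have "((\<lambda>h. flat_exp P h / h) \<longlongrightarrow> 0) (at_right 0)"
    proof -
      have "((\<lambda>h. poly (pCons 0 P) (inverse h) * exp (- inverse h)) \<longlongrightarrow> (0::real)) (at_right 0)"
        by (rule filterlim_compose[OF poly_times_exp_minus_tendsto_0 filterlim_inverse_at_top_right])
      then show ?thesis
        by (rule Lim_transform_eventually)
           (auto simp: eventually_at_filter flat_exp_def field_simps)
    qed
    moreover have "((\<lambda>h. flat_exp P h / h) \<longlongrightarrow> 0) (at_left 0)"
      by (rule Lim_transform_eventually[OF tendsto_const])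
         (auto simp: eventually_at_filter flat_exp_def)
    ultimately have "((\<lambda>h. flat_exp P h / h) \<longlongrightarrow> 0) (at 0)"
      by (rule filterlim_split_at[rotated])
    then show ?thesis
      using 3 by (simp add: DERIV_def) (simp add: flat_exp_def)
  qed
qed

lemma Ck_on_flat_exp:
  assumes "open S" "smooth_on S g"
  shows "Ck_on k S (\<lambda>x. flat_exp P (g x))"
proof (induction k arbitrary: P)
  case 0
  have "continuous_on UNIV (flat_exp P)"
    using flat_exp_has_real_derivative DERIV_isCont by (blast intro: continuous_at_imp_continuous_on)
  then have "continuous_on S (\<lambda>x. flat_exp P (g x))"
    using smooth_on_continuous[OF assms(2)] continuous_on_compose2 by blast
  then show ?case by simp
next
  case (Suc k)
  let ?Q = "monom 1 2 * (P - pderiv P)"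
  show ?case
  proof (rule Ck_on_SucI[OF assms(1)])
    show "((\<lambda>x. flat_exp P (g x)) has_derivative (\<lambda>v. dd g v x * flat_exp ?Q (g x))) (at x)"
      if "x \<in> S" for x
      using flat_exp_has_real_derivative smooth_on_has_derivative[OF assms(2) that]
      by (rule DERIV_compose_FDERIV)
    show "Ck_on k S (\<lambda>x. dd g v x * flat_exp ?Q (g x))" for v
      using smooth_on_dd[OF assms(2)] Suc
      by (intro Ck_on_bounded_bilinear[OF assms(1) bounded_bilinear_mult]) (auto simp: smooth_on_def)
  qed
qed

text \<open>Serves to cut off a form defined near \<open>p\<close>, since a contact form has to be given on all of \<open>M\<close>.\<close>

lemma smooth_bump:
  fixes p :: "'a::euclidean_space"
  assumes "r > 0"
  obtains \<phi> :: "'a \<Rightarrow> real" where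
    "smooth_on UNIV \<phi>" "\<phi> p > 0" "\<And>x. r \<le> dist p x \<Longrightarrow> \<phi> x = 0"
proof
  define \<phi> :: "'a \<Rightarrow> real" where "\<phi> x = flat_exp 1 (r\<^sup>2 - (x - p) \<bullet> (x - p))" for x
  show "smooth_on UNIV \<phi>"
    unfolding \<phi>_def smooth_on_def
    by (intro allI Ck_on_flat_exp smooth_on_diff smooth_on_const smooth_on_id
        smooth_on_bounded_bilinear[OF _ bounded_bilinear_inner]) auto
  show "\<phi> p > 0"
    using assms by (simp add: \<phi>_def flat_exp_def)
  show "\<phi> x = 0" if "r \<le> dist p x" for x
  proof -
    have "r\<^sup>2 \<le> (dist p x)\<^sup>2" using that assms by (intro power_mono) auto
    then have "r\<^sup>2 \<le> (x - p) \<bullet> (x - p)"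
      unfolding dist_commute[of p x] by (simp add: dist_norm power2_norm_eq_inner)
    then show ?thesis by (simp add: \<phi>_def flat_exp_def)
  qed
qed

section \<open>Symmetry of second derivatives\<close>

text \<open>The mean value theorem, first in the direction \<open>u\<close> for the increment in the direction \<open>v\<close>, then in
the direction \<open>v\<close> for the derivative along \<open>u\<close>.\<close>

lemma second_difference:
  fixes f :: "'a::euclidean_space \<Rightarrow> real"
  assumes "smooth_on (ball x r) f" "t > 0" "t * norm u + t * norm v < r"
  shows "\<exists>y \<in> cball x (t * norm u + t * norm v).
    f (x + t *\<^sub>R u + t *\<^sub>R v) - f (x + t *\<^sub>R u) - f (x + t *\<^sub>R v) + f x = t\<^sup>2 * dd (dd f u) v y"
proof -
  have near: "x + s *\<^sub>R u + s' *\<^sub>R v \<in> cball x (t * norm u + t * norm v)"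
    if "0 \<le> s" "s \<le> t" "0 \<le> s'" "s' \<le> t" for s s'
  proof -
    have "norm (s *\<^sub>R u + s' *\<^sub>R v) \<le> t * norm u + t * norm v"
      using that by (intro order_trans[OF norm_triangle_ineq] add_mono) (auto intro: mult_right_mono)
    then have "dist x (x + (s *\<^sub>R u + s' *\<^sub>R v)) \<le> t * norm u + t * norm v"
      unfolding dist_commute[of x] by (simp add: dist_norm)
    then show ?thesis by (simp add: add.assoc)
  qed
  have inb: "x + s *\<^sub>R u + s' *\<^sub>R v \<in> ball x r"
    if "0 \<le> s" "s \<le> t" "0 \<le> s'" "s' \<le> t" for s s'
    using near[OF that] assms(3) by auto
  have chain: "((\<lambda>s. h (a + s *\<^sub>R w)) has_real_derivative dd h w (a + s *\<^sub>R w)) (at s)"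
    if "smooth_on (ball x r) h" "a + s *\<^sub>R w \<in> ball x r" for h :: "'a \<Rightarrow> real" and a w s
  proof -
    have h: "(h has_derivative (\<lambda>v. dd h v (a + s *\<^sub>R w))) (at (a + s *\<^sub>R w))"
      by (rule smooth_on_has_derivative[OF that])
    have "((\<lambda>s. h (a + s *\<^sub>R w)) has_derivative (\<lambda>k. dd h (k *\<^sub>R w) (a + s *\<^sub>R w))) (at s)"
      by (rule has_derivative_compose[of "\<lambda>s. a + s *\<^sub>R w" "\<lambda>k. k *\<^sub>R w", OF _ h])
         (auto intro!: derivative_eq_intros)
    then show ?thesis
      using linear_scale[OF has_derivative_linear[OF h]]
      by (simp add: has_field_derivative_def mult.commute[of _ "dd h w _"] fun_eq_iff)
  qed
  define g where "g s = f (x + t *\<^sub>R v + s *\<^sub>R u) - f (x + s *\<^sub>R u)" for s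
  have "\<exists>z>0. z < t \<and> g t - g 0 = (t - 0) * (dd f u (x + t *\<^sub>R v + z *\<^sub>R u) - dd f u (x + z *\<^sub>R u))"
  proof (rule MVT2[OF assms(2)])
    fix s assume s: "0 \<le> s" "s \<le> t"
    have "x + t *\<^sub>R v + s *\<^sub>R u \<in> ball x r" "x + s *\<^sub>R u \<in> ball x r"
      using inb[of s t] inb[of s 0] s assms(2) by (simp_all add: add_ac)
    then show "(g has_real_derivative dd f u (x + t *\<^sub>R v + s *\<^sub>R u) - dd f u (x + s *\<^sub>R u)) (at s)"
      unfolding g_def by (intro DERIV_diff chain[OF assms(1)])
  qed
  then obtain z where z: "0 < z" "z < t"
    "g t - g 0 = t * (dd f u (x + t *\<^sub>R v + z *\<^sub>R u) - dd f u (x + z *\<^sub>R u))" by auto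
  have "\<exists>w>0. w < t \<and> dd f u (x + z *\<^sub>R u + t *\<^sub>R v) - dd f u (x + z *\<^sub>R u + 0 *\<^sub>R v) =
      (t - 0) * dd (dd f u) v (x + z *\<^sub>R u + w *\<^sub>R v)"
    by (rule MVT2[OF assms(2)], rule chain[OF smooth_on_dd[OF assms(1)]])
       (use inb z in auto)
  then obtain w where w: "0 < w" "w < t"
    "dd f u (x + z *\<^sub>R u + t *\<^sub>R v) - dd f u (x + z *\<^sub>R u) = t * dd (dd f u) v (x + z *\<^sub>R u + w *\<^sub>R v)"
    by auto
  have "g t - g 0 = t\<^sup>2 * dd (dd f u) v (x + z *\<^sub>R u + w *\<^sub>R v)"
    using z(3) w(3) by (simp add: power2_eq_square add_ac)
  then show ?thesis
    using near[of z w] z w unfolding g_def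
    by (intro bexI[of _ "x + z *\<^sub>R u + w *\<^sub>R v"]) (auto simp: algebra_simps)
qed

text \<open>The second difference is symmetric in \<open>u\<close> and \<open>v\<close>, and divided by \<open>t\<^sup>2\<close> it is close, for small \<open>t\<close>,
to either mixed derivative.\<close>

lemma second_derivative_symmetric:
  fixes f :: "'a::euclidean_space \<Rightarrow> real"
  assumes "open U" "x \<in> U" "smooth_on U f"
  shows "dd (dd f u) v x = dd (dd f v) u x"
proof (rule ccontr)
  assume ne: "dd (dd f u) v x \<noteq> dd (dd f v) u x"
  define e where "e = \<bar>dd (dd f u) v x - dd (dd f v) u x\<bar> / 2"
  have "e > 0" using ne by (simp add: e_def)
  obtain r where r: "r > 0" "ball x r \<subseteq> U" using assms(1,2) open_contains_ball by blast
  have sm: "smooth_on (ball x r) f" using smooth_on_subset assms(3) r by blast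
  have cont: "\<exists>d>0. d \<le> r \<and> (\<forall>y. dist y x < d \<longrightarrow> \<bar>dd (dd f a) b y - dd (dd f a) b x\<bar> < e)" for a b
  proof -
    have "continuous_on (ball x r) (dd (dd f a) b)"
      by (intro smooth_on_continuous smooth_on_dd sm)
    then have "continuous (at x) (dd (dd f a) b)"
      using r by (simp add: continuous_on_eq_continuous_at)
    then obtain d where "d > 0" "\<forall>y. dist y x < d \<longrightarrow> dist (dd (dd f a) b y) (dd (dd f a) b x) < e"
      using \<open>e > 0\<close> unfolding continuous_at_eps_delta by blast
    then show ?thesis
      using r by (intro exI[of _ "min d r"]) (auto simp: dist_real_def)
  qed
  obtain d1 where d1: "d1 > 0" "d1 \<le> r" "\<And>y. dist y x < d1 \<Longrightarrow> \<bar>dd (dd f u) v y - dd (dd f u) v x\<bar> < e"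
    using cont by blast
  obtain d2 where d2: "d2 > 0" "d2 \<le> r" "\<And>y. dist y x < d2 \<Longrightarrow> \<bar>dd (dd f v) u y - dd (dd f v) u x\<bar> < e"
    using cont by blast
  define d where "d = min d1 d2"
  \<comment> \<open>the summand \<open>1\<close> keeps the divisor in \<open>t\<close> positive when \<open>u\<close> and \<open>v\<close> vanish\<close>
  define N where "N = norm u + norm v + 1"
  define t where "t = d / (2 * N)"
  have N: "N > 0" using norm_ge_zero[of u] norm_ge_zero[of v] unfolding N_def by linarith
  have d: "d > 0" "d \<le> r" using d1 d2 by (auto simp: d_def)
  have t: "t > 0" using N d by (simp add: t_def)
  have "t * norm u + t * norm v \<le> t * N"
    using t by (simp add: N_def distrib_left)
  also have "\<dots> < d" using N d by (simp add: t_def)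
  finally have tl: "t * norm u + t * norm v < d" .
  obtain y1 where y1: "y1 \<in> cball x (t * norm u + t * norm v)"
    "f (x + t *\<^sub>R u + t *\<^sub>R v) - f (x + t *\<^sub>R u) - f (x + t *\<^sub>R v) + f x = t\<^sup>2 * dd (dd f u) v y1"
    using second_difference[OF sm t, of u v] tl d by auto
  obtain y2 where y2: "y2 \<in> cball x (t * norm v + t * norm u)"
    "f (x + t *\<^sub>R v + t *\<^sub>R u) - f (x + t *\<^sub>R v) - f (x + t *\<^sub>R u) + f x = t\<^sup>2 * dd (dd f v) u y2"
    using second_difference[OF sm t, of v u] tl d by auto
  have "x + t *\<^sub>R v + t *\<^sub>R u = x + t *\<^sub>R u + t *\<^sub>R v" by (simp add: add_ac)
  from y2(2)[unfolded this] have "t\<^sup>2 * dd (dd f u) v y1 = t\<^sup>2 * dd (dd f v) u y2"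
    using y1(2) by linarith
  then have "dd (dd f u) v y1 = dd (dd f v) u y2" using t by simp
  moreover have "\<bar>dd (dd f u) v y1 - dd (dd f u) v x\<bar> < e"
    using y1(1) tl by (intro d1(3)) (auto simp: d_def dist_commute)
  moreover have "\<bar>dd (dd f v) u y2 - dd (dd f v) u x\<bar> < e"
    using y2(1) tl by (intro d2(3)) (auto simp: d_def dist_commute)
  ultimately show False unfolding e_def by (simp add: abs_if split: if_splits)
qed

section \<open>Families of linear maps\<close>

lemma linear_family_expand:
  fixes l :: "'v::euclidean_space \<Rightarrow> 'b::real_normed_vector"
  assumes "linear l"
  shows "l v = (\<Sum>b\<in>Basis. (v \<bullet> b) *\<^sub>R l b)"
proof -
  have "l v = l (\<Sum>b\<in>Basis. (v \<bullet> b) *\<^sub>R b)"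
    by (simp add: euclidean_representation)
  also have "\<dots> = (\<Sum>b\<in>Basis. (v \<bullet> b) *\<^sub>R l b)"
    using assms by (simp add: linear_sum linear_scale)
  finally show ?thesis .
qed

text \<open>Product rule for evaluating a variable linear map at a variable vector. Since the map is determined
by its values on a finite basis, differentiability of \<open>x \<mapsto> f x v\<close> for each fixed \<open>v\<close> is enough, and no
norm on the space of linear maps enters.\<close>

lemma has_derivative_linear_family:
  fixes f :: "'a::real_normed_vector \<Rightarrow> 'v::euclidean_space \<Rightarrow> 'b::real_normed_vector"
  assumes "p \<in> S" and lin: "eventually (\<lambda>x. linear (f x)) (at p within S)" "linear (f p)" and lin': "\<And>h. linear (\<lambda>v. f' v h)"
    and f: "\<And>v. ((\<lambda>x. f x v) has_derivative f' v) (at p within S)"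
    and X: "(X has_derivative X') (at p within S)"
  shows "((\<lambda>x. f x (X x)) has_derivative (\<lambda>h. f p (X' h) + f' (X p) h)) (at p within S)"
proof -
  have "((\<lambda>x. \<Sum>b\<in>Basis. (X x \<bullet> b) *\<^sub>R f x b) has_derivative
      (\<lambda>h. \<Sum>b\<in>Basis. (X p \<bullet> b) *\<^sub>R f' b h + (X' h \<bullet> b) *\<^sub>R f p b)) (at p within S)"
    by (intro has_derivative_sum has_derivative_scaleR f has_derivative_inner_left X)
  also have "(\<lambda>h. \<Sum>b\<in>Basis. (X p \<bullet> b) *\<^sub>R f' b h + (X' h \<bullet> b) *\<^sub>R f p b)
      = (\<lambda>h. f p (X' h) + f' (X p) h)"
    by (subst linear_family_expand[OF lin(2), of "X' _"], subst linear_family_expand[OF lin', of "X p"])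
       (simp add: sum.distrib add.commute)
  finally show ?thesis
  proof (rule has_derivative_transform_eventually)
    show "eventually (\<lambda>x. (\<Sum>b\<in>Basis. (X x \<bullet> b) *\<^sub>R f x b) = f x (X x)) (at p within S)"
      using lin(1) by eventually_elim (metis linear_family_expand)
    show "(\<Sum>b\<in>Basis. (X p \<bullet> b) *\<^sub>R f p b) = f p (X p)"
      by (rule linear_family_expand[OF lin(2), symmetric])
  qed (rule \<open>p \<in> S\<close>)
qed

lemma linear_frechet_derivative_family:
  fixes f :: "'a::real_normed_vector \<Rightarrow> 'v::real_vector \<Rightarrow> 'b::real_normed_vector"
  assumes U: "open U" "p \<in> U" and lin: "\<And>x. x \<in> U \<Longrightarrow> linear (f x)"
    and f: "\<And>v. (\<lambda>x. f x v) differentiable (at p)"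
  shows "linear (\<lambda>v. dd (\<lambda>x. f x v) h p)"
proof (rule linearI)
  have D: "((\<lambda>x. f x v) has_derivative (\<lambda>h. dd (\<lambda>x. f x v) h p)) (at p)" for v
    using f frechet_derivative_works by blast
  fix v w and c :: real
  have "((\<lambda>x. f x (v + w)) has_derivative (\<lambda>h. dd (\<lambda>x. f x v) h p + dd (\<lambda>x. f x w) h p)) (at p)"
    by (rule has_derivative_transform_within_open[OF has_derivative_add[OF D D] U])
       (simp add: lin linear_add)
  then show "dd (\<lambda>x. f x (v + w)) h p = dd (\<lambda>x. f x v) h p + dd (\<lambda>x. f x w) h p"
    by (metis frechet_derivative_at)
  have "((\<lambda>x. f x (c *\<^sub>R v)) has_derivative (\<lambda>h. c *\<^sub>R dd (\<lambda>x. f x v) h p)) (at p)"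
    by (rule has_derivative_transform_within_open[OF has_derivative_scaleR_right[OF D] U])
       (simp add: lin linear_scale)
  then show "dd (\<lambda>x. f x (c *\<^sub>R v)) h p = c *\<^sub>R dd (\<lambda>x. f x v) h p"
    by (metis frechet_derivative_at)
qed

section \<open>Hypersurfaces in terms of a defining function\<close>

abbreviation J :: "complex ^ 'n \<Rightarrow> complex ^ 'n" where
  "J v \<equiv> \<i> *s v"

lemma linear_J: "linear (J :: complex ^ 'n \<Rightarrow> _)"
  by (rule linearI) (simp_all add: vec_eq_iff algebra_simps)

lemma J_J: "J (J v) = - v"
  by (simp add: vec_eq_iff)

lemmas J_simps = J_J linear_add[OF linear_J] linear_diff[OF linear_J] linear_neg[OF linear_J]
  linear_scale[OF linear_J] linear_0[OF linear_J]

lemma has_derivative_J: "(f has_derivative f') F \<Longrightarrow> ((\<lambda>x. J (f x)) has_derivative (\<lambda>h. J (f' h))) F"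
  using bounded_linear.has_derivative linear_J linear_conv_bounded_linear by blast

lemma inner_J_self: "v \<bullet> J v = 0"
  by (simp add: inner_vec_def inner_complex_def)

lemma eventually_nhds_isCont:
  assumes "isCont f x" "open S" "f x \<in> S"
  shows "\<forall>\<^sub>F y in nhds x. f y \<in> S"
  using assms unfolding isCont_def tendsto_at_iff_tendsto_nhds by (blast intro: topological_tendstoD)

text \<open>All constructions take place in the domain \<open>U\<close> of one local defining function; only the contact forms
live on the whole of \<open>M\<close>.\<close>

locale hypersurface_chart =
  fixes M U :: "(complex ^ 'n) set" and \<rho> :: "complex ^ 'n \<Rightarrow> real"
  assumes open_U: "open U" and smooth_\<rho>: "smooth_on U \<rho>" and M_iff: "M \<inter> U = {x \<in> U. \<rho> x = 0}"
    and regular: "\<And>x. x \<in> M \<inter> U \<Longrightarrow> \<exists>v. frechet_derivative \<rho> (at x) v \<noteq> 0"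
begin

definition d\<rho> :: "complex ^ 'n \<Rightarrow> complex ^ 'n \<Rightarrow> real" where
  "d\<rho> q v = dd \<rho> v q"

text \<open>The second argument is the slot of \<open>d\<rho>\<close>, the first the direction of differentiation.\<close>

definition hess :: "complex ^ 'n \<Rightarrow> complex ^ 'n \<Rightarrow> complex ^ 'n \<Rightarrow> real" where
  "hess q u v = dd (dd \<rho> v) u q"

lemma \<rho>_has_derivative: "q \<in> U \<Longrightarrow> (\<rho> has_derivative d\<rho> q) (at q within S)"
  using smooth_on_has_derivative[OF smooth_\<rho>] unfolding d\<rho>_def by (blast intro: has_derivative_at_withinI)

lemma linear_d\<rho>: "q \<in> U \<Longrightarrow> linear (d\<rho> q)"
  using \<rho>_has_derivative has_derivative_linear by blast

lemmas d\<rho>_simps = linear_add[OF linear_d\<rho>] linear_diff[OF linear_d\<rho>] linear_neg[OF linear_d\<rho>]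
  linear_scale[OF linear_d\<rho>] linear_0[OF linear_d\<rho>]

lemma smooth_d\<rho>: "smooth_on U (\<lambda>x. d\<rho> x v)"
  unfolding d\<rho>_def by (rule smooth_on_dd[OF smooth_\<rho>])

lemma d\<rho>_has_derivative: "q \<in> U \<Longrightarrow> ((\<lambda>x. d\<rho> x v) has_derivative (\<lambda>u. hess q u v)) (at q within S)"
  using smooth_on_has_derivative[OF smooth_d\<rho>, of q v] unfolding d\<rho>_def hess_def
  by (blast intro: has_derivative_at_withinI)

lemma hess_symmetric: "q \<in> U \<Longrightarrow> hess q u v = hess q v u"
  unfolding hess_def by (rule second_derivative_symmetric[OF open_U _ smooth_\<rho>])

lemma linear_hess_left: "q \<in> U \<Longrightarrow> linear (\<lambda>u. hess q u v)"
  using d\<rho>_has_derivative has_derivative_linear by blast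

lemma linear_hess_right:
  assumes "q \<in> U"
  shows "linear (hess q u)"
proof -
  have "hess q u = (\<lambda>w. hess q w u)"
    by (rule ext) (rule hess_symmetric[OF assms])
  then show ?thesis using linear_hess_left[OF assms, of u] by metis
qed

lemmas hess_simps =
  linear_add[OF linear_hess_left] linear_diff[OF linear_hess_left] linear_neg[OF linear_hess_left]
  linear_scale[OF linear_hess_left] linear_0[OF linear_hess_left]
  linear_add[OF linear_hess_right] linear_diff[OF linear_hess_right] linear_neg[OF linear_hess_right]
  linear_scale[OF linear_hess_right] linear_0[OF linear_hess_right]

lemma smooth_hess: "smooth_on U (\<lambda>x. hess x u v)"
  unfolding hess_def by (intro smooth_on_dd smooth_\<rho>)

text \<open>A substitute for the implicit function theorem. Near \<open>q\<close> the derivative of \<open>\<rho>\<close> along \<open>w\<close> exceeds \<open>1/2\<close>,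
so \<open>s \<mapsto> \<rho> (q + t v + s w)\<close> starts with the value \<open>\<rho> (q + t v)\<close> and changes sign within distance
\<open>2 \<bar>\<rho> (q + t v)\<bar>\<close>.\<close>

lemma zero_near_tangent_line:
  assumes q: "q \<in> M \<inter> U" and w: "d\<rho> q w = 1"
  shows "\<forall>\<^sub>F t in nhds 0. \<exists>s. \<bar>s\<bar> \<le> 2 * \<bar>\<rho> (q + t *\<^sub>R v)\<bar> \<and> q + t *\<^sub>R v + s *\<^sub>R w \<in> M"
proof -
  have qU: "q \<in> U" using q by blast
  have "\<rho> q = 0" using q M_iff by blast
  have "isCont (\<lambda>x. d\<rho> x w) q"
    using smooth_on_continuous[OF smooth_d\<rho>] open_U qU by (simp add: continuous_on_eq_continuous_at)
  then have "\<forall>\<^sub>F x in nhds q. d\<rho> x w > 1/2"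
    using eventually_nhds_isCont[of q "\<lambda>x. d\<rho> x w" "{1/2<..}"] w by simp
  then have "\<forall>\<^sub>F x in nhds q. x \<in> U \<and> d\<rho> x w > 1/2"
    using eventually_nhds_in_open[OF open_U qU] by (rule eventually_conj[rotated])
  then obtain r where r: "r > 0" "\<And>x. dist x q < r \<Longrightarrow> x \<in> U \<and> d\<rho> x w > 1/2"
    unfolding eventually_nhds_metric by blast
  \<comment> \<open>the length of the segment in direction \<open>w\<close> that is searched for a zero\<close>
  define m where "m t = 2 * \<bar>\<rho> (q + t *\<^sub>R v)\<bar>" for t
  have "isCont \<rho> q"
    using \<rho>_has_derivative[OF qU] has_derivative_continuous by blast
  have "isCont (\<lambda>t. \<rho> (q + t *\<^sub>R v)) 0"
    by (rule isCont_o2[where g = \<rho>]) (use \<open>isCont \<rho> q\<close> in auto)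
  then have "isCont (\<lambda>t. \<bar>t\<bar> * norm v + m t * norm w) 0"
    unfolding m_def by (intro continuous_intros) auto
  then have "\<forall>\<^sub>F t in nhds 0. \<bar>t\<bar> * norm v + m t * norm w < r"
    using eventually_nhds_isCont[of 0 "\<lambda>t. \<bar>t\<bar> * norm v + m t * norm w" "{..<r}"] r(1) \<open>\<rho> q = 0\<close>
    by (simp add: m_def)
  then show ?thesis
  proof eventually_elim
    case (elim t)
    define F where "F s = \<rho> (q + t *\<^sub>R v + s *\<^sub>R w)" for s
    have inball: "dist (q + t *\<^sub>R v + s *\<^sub>R w) q < r" if "\<bar>s\<bar> \<le> m t" for s
    proof -
      have "dist (q + t *\<^sub>R v + s *\<^sub>R w) q = norm (t *\<^sub>R v + s *\<^sub>R w)"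
        by (simp add: dist_norm add.assoc)
      also have "\<dots> \<le> norm (t *\<^sub>R v) + norm (s *\<^sub>R w)" by (rule norm_triangle_ineq)
      also have "\<dots> \<le> \<bar>t\<bar> * norm v + m t * norm w" using that by (simp add: mult_right_mono)
      finally show ?thesis using elim by linarith
    qed
    have F': "(F has_real_derivative d\<rho> (q + t *\<^sub>R v + s *\<^sub>R w) w) (at s)" if "\<bar>s\<bar> \<le> m t" for s
    proof -
      let ?x = "q + t *\<^sub>R v + s *\<^sub>R w"
      have xU: "?x \<in> U" using r(2)[OF inball[OF that]] by simp
      have "(F has_derivative (\<lambda>k. d\<rho> ?x (k *\<^sub>R w))) (at s)"
        unfolding F_def
        by (rule has_derivative_compose[of "\<lambda>s. q + t *\<^sub>R v + s *\<^sub>R w" "\<lambda>k. k *\<^sub>R w", OF _ \<rho>_has_derivative[OF xU]])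
           (auto intro!: derivative_eq_intros)
      then show ?thesis
        using xU by (simp add: has_field_derivative_def d\<rho>_simps mult.commute[of _ "d\<rho> ?x w"])
    qed
    have half: "d\<rho> (q + t *\<^sub>R v + s *\<^sub>R w) w > 1/2" if "\<bar>s\<bar> \<le> m t" for s
      using r(2)[OF inball[OF that]] by simp
    \<comment> \<open>slope at least \<open>1/2\<close> over length \<open>m t\<close> outweighs the initial value, of size \<open>m t / 2\<close>\<close>
    have grow: "F b - F a \<ge> (b - a) / 2" if "- m t \<le> a" "a \<le> b" "b \<le> m t" for a b
    proof (cases "a = b")
      case False
      then have "a < b" using that by simp
      have "\<exists>z>a. z < b \<and> F b - F a = (b - a) * d\<rho> (q + t *\<^sub>R v + z *\<^sub>R w) w"
        by (rule MVT2[OF \<open>a < b\<close>], rule F') (use that in linarith)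
      then obtain z where z: "a < z" "z < b"
        "F b - F a = (b - a) * d\<rho> (q + t *\<^sub>R v + z *\<^sub>R w) w"
        by blast
      have "d\<rho> (q + t *\<^sub>R v + z *\<^sub>R w) w \<ge> 1/2" using half[of z] z that by linarith
      then have "(b - a) * (1/2) \<le> (b - a) * d\<rho> (q + t *\<^sub>R v + z *\<^sub>R w) w"
        using \<open>a < b\<close> by (intro mult_left_mono) auto
      then show ?thesis using z by simp
    qed simp
    have "m t \<ge> 0" "\<bar>F 0\<bar> = m t / 2" by (simp_all add: m_def F_def)
    then have "F (- m t) \<le> 0" "0 \<le> F (m t)"
      using grow[of "- m t" 0] grow[of 0 "m t"] by (auto simp: abs_if split: if_splits)
    moreover have "continuous_on {- m t..m t} F"
      by (intro continuous_at_imp_continuous_on ballI DERIV_isCont[OF F']) (auto simp: abs_le_iff)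
    ultimately obtain s where s: "- m t \<le> s" "s \<le> m t" "F s = 0"
      using IVT'[of F "- m t" 0 "m t"] \<open>m t \<ge> 0\<close> by auto
    then have "\<bar>s\<bar> \<le> m t" by linarith
    moreover have "q + t *\<^sub>R v + s *\<^sub>R w \<in> M"
      using r(2)[OF inball[OF \<open>\<bar>s\<bar> \<le> m t\<close>]] s(3) M_iff unfolding F_def by blast
    ultimately show ?case unfolding m_def by blast
  qed
qed

text \<open>For \<open>v\<close> in the kernel of \<open>d\<rho>\<close>, the line \<open>q + t v\<close> is moved into \<open>M\<close> by a correction bounded by
\<open>2 \<bar>\<rho> (q + t v)\<bar>\<close>, which is \<open>o(t)\<close>. The resulting curve may jump away from \<open>t = 0\<close>, but it has
velocity \<open>v\<close> at \<open>0\<close>, and this is all that a tangent vector requires.\<close>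

lemma tangent_space_iff:
  assumes q: "q \<in> M \<inter> U"
  shows "v \<in> tangent_space M q \<longleftrightarrow> d\<rho> q v = 0"
proof
  have qU: "q \<in> U" using q by blast
  assume v: "v \<in> tangent_space M q"
  show "d\<rho> q v = 0"
    by (rule tangential_derivative_unique[OF \<rho>_has_derivative[OF qU] has_derivative_const[of 0] open_U qU _ _ v])
       (use q M_iff in blast)+
next
  have qU: "q \<in> U" and "\<rho> q = 0" using q M_iff by blast+
  assume v: "d\<rho> q v = 0"
  obtain w0 where w0: "d\<rho> q w0 \<noteq> 0" using regular[OF q] by (auto simp: d\<rho>_def)
  define w where "w = (1 / d\<rho> q w0) *\<^sub>R w0"
  have w: "d\<rho> q w = 1" using w0 qU by (simp add: w_def d\<rho>_simps)
  obtain \<epsilon> where \<epsilon>: "\<epsilon> > 0"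
    "\<And>t. dist t 0 < \<epsilon> \<Longrightarrow> \<exists>s. \<bar>s\<bar> \<le> 2 * \<bar>\<rho> (q + t *\<^sub>R v)\<bar> \<and> q + t *\<^sub>R v + s *\<^sub>R w \<in> M"
    using zero_near_tangent_line[OF q w, of v] unfolding eventually_nhds_metric by blast
  define s where "s t = (SOME s. \<bar>s\<bar> \<le> 2 * \<bar>\<rho> (q + t *\<^sub>R v)\<bar> \<and> q + t *\<^sub>R v + s *\<^sub>R w \<in> M)" for t
  have s: "\<bar>s t\<bar> \<le> 2 * \<bar>\<rho> (q + t *\<^sub>R v)\<bar> \<and> q + t *\<^sub>R v + s t *\<^sub>R w \<in> M" if "\<bar>t\<bar> < \<epsilon>" for t
    unfolding s_def by (rule someI_ex) (use \<epsilon>(2)[of t] that in auto)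
  have s0: "s 0 = 0" using s[of 0] \<epsilon>(1) \<open>\<rho> q = 0\<close> by simp
  have "((\<lambda>t. \<rho> (q + t *\<^sub>R v)) has_derivative (\<lambda>k. d\<rho> q (k *\<^sub>R v))) (at 0)"
    by (rule has_derivative_compose[of "\<lambda>t. q + t *\<^sub>R v" "\<lambda>k. k *\<^sub>R v"])
       (auto intro!: derivative_eq_intros \<rho>_has_derivative qU)
  then have "((\<lambda>t. \<rho> (q + t *\<^sub>R v)) has_real_derivative 0) (at 0)"
    using qU v by (simp add: has_field_derivative_def d\<rho>_simps lambda_zero[symmetric])
  then have "((\<lambda>t. \<rho> (q + t *\<^sub>R v) / t) \<longlongrightarrow> 0) (at 0)"
    using \<open>\<rho> q = 0\<close> by (simp add: DERIV_def)
  from tendsto_mult_right_zero[OF tendsto_rabs_zero[OF this], of 2]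
  have lim: "((\<lambda>t. 2 * \<bar>\<rho> (q + t *\<^sub>R v) / t\<bar>) \<longlongrightarrow> 0) (at 0)" .
  have "((\<lambda>t. s t / t) \<longlongrightarrow> 0) (at 0)"
  proof (rule Lim_null_comparison[OF _ lim])
    have "\<forall>\<^sub>F t in at (0::real). \<bar>t\<bar> < \<epsilon>"
      using \<epsilon>(1) by (auto simp: eventually_at dist_real_def)
    then show "\<forall>\<^sub>F t in at 0. norm (s t / t) \<le> 2 * \<bar>\<rho> (q + t *\<^sub>R v) / t\<bar>"
      by eventually_elim (use s in \<open>auto simp: divide_right_mono\<close>)
  qed
  then have "(s has_real_derivative 0) (at 0)"
    by (simp add: DERIV_def s0)
  then have "((\<lambda>t. q + t *\<^sub>R v + s t *\<^sub>R w) has_vector_derivative v) (at 0)"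
    by (auto intro!: derivative_eq_intros simp: has_real_derivative_iff_has_vector_derivative[symmetric])
  then show "v \<in> tangent_space M q"
    unfolding tangent_space_def using \<epsilon>(1) s s0
    by (auto intro!: exI[of _ "\<lambda>t. q + t *\<^sub>R v + s t *\<^sub>R w"] exI[of _ \<epsilon>] simp: abs_less_iff)
qed

lemma complex_tangent_space_iff:
  "q \<in> M \<inter> U \<Longrightarrow> v \<in> complex_tangent_space M q \<longleftrightarrow> d\<rho> q v = 0 \<and> d\<rho> q (J v) = 0"
  by (auto simp: complex_tangent_space_def tangent_space_iff)

lemma CT_iff: "q \<in> M \<inter> U \<Longrightarrow> v \<in> CT M q \<longleftrightarrow> d\<rho> q (fst v) = 0 \<and> d\<rho> q (snd v) = 0"
  by (auto simp: CT_def tangent_space_iff mem_Times_iff)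

lemma CH_iff: "q \<in> M \<inter> U \<Longrightarrow> v \<in> CH M q \<longleftrightarrow>
    d\<rho> q (fst v) = 0 \<and> d\<rho> q (J (fst v)) = 0 \<and> d\<rho> q (snd v) = 0 \<and> d\<rho> q (J (snd v)) = 0"
  by (auto simp: CH_def complex_tangent_space_iff mem_Times_iff)

lemma H10_iff: "v \<in> H10 M q \<longleftrightarrow> v \<in> CH M q \<and> snd v = - J (fst v)"
proof -
  have "cplx_J v = cscale \<i> v \<longleftrightarrow> snd v = - J (fst v)"
    by (cases v) (auto simp: cplx_J_def cscale_def J_simps)
  then show ?thesis by (simp add: H10_def)
qed

lemma cconj_CH: "q \<in> M \<inter> U \<Longrightarrow> cconj v \<in> CH M q \<longleftrightarrow> v \<in> CH M q"
  by (auto simp: CH_iff cconj_def d\<rho>_simps J_simps)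

lemma H10_bar_iff:
  assumes "q \<in> M \<inter> U"
  shows "v \<in> H10_bar M q \<longleftrightarrow> v \<in> CH M q \<and> snd v = J (fst v)"
proof -
  have "v \<in> H10_bar M q \<longleftrightarrow> cconj v \<in> H10 M q"
    unfolding H10_bar_def by (force simp: cconj_def image_iff)
  then show ?thesis using assms by (simp add: H10_iff cconj_CH) (simp add: cconj_def)
qed

text \<open>If \<open>n\<close> is the gradient of \<open>\<rho>\<close>, then \<open>J n\<close> is orthogonal to \<open>n\<close>, so a multiple of \<open>J n\<close> is the vector
wanted: it is tangent to \<open>M\<close> and spans the tangent space modulo the complex tangent space.\<close>

lemma transversal_exists:
  assumes "q \<in> M \<inter> U"
  shows "\<exists>e. d\<rho> q e = 0 \<and> d\<rho> q (J e) = 1"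
proof -
  have qU: "q \<in> U" using assms by blast
  define n where "n = (\<Sum>b\<in>Basis. d\<rho> q b *\<^sub>R b)"
  have dn: "d\<rho> q v = v \<bullet> n" for v
    using linear_family_expand[OF linear_d\<rho>[OF qU], of v]
    by (simp add: n_def inner_sum_right mult.commute)
  have "n \<noteq> 0" using regular[OF assms] dn by (auto simp: d\<rho>_def[symmetric])
  let ?e = "- (1 / (n \<bullet> n)) *\<^sub>R J n"
  have "d\<rho> q ?e = 0" by (simp add: dn inner_J_self inner_commute[of "J n"])
  moreover have "d\<rho> q (J ?e) = 1" using \<open>n \<noteq> 0\<close> by (simp add: J_simps dn)
  ultimately show ?thesis by blast
qed

text \<open>The Leibniz rule for the relation \<open>d\<rho> (Z) = 0\<close> along \<open>M\<close>. It trades a derivative of a section for a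
Hessian term that depends only on the value of the section.\<close>

lemma derivative_of_annihilated:
  assumes q: "q \<in> M \<inter> U" and V: "open V" "q \<in> V" and Z: "\<And>x. x \<in> M \<inter> V \<Longrightarrow> d\<rho> x (Z x) = 0"
    and Z': "(Z has_derivative Z') (at q within M)" and h: "h \<in> tangent_space M q"
  shows "d\<rho> q (Z' h) = - hess q h (Z q)"
proof -
  have qU: "q \<in> U" using q by blast
  have "((\<lambda>x. d\<rho> x (Z x)) has_derivative (\<lambda>h. d\<rho> q (Z' h) + hess q h (Z q))) (at q within M)"
  proof (rule has_derivative_linear_family[OF _ _ _ _ _ Z'])
    show "\<forall>\<^sub>F x in at q within M. linear (d\<rho> x)"
      using open_U qU linear_d\<rho> by (auto simp: eventually_at_topological)
    show "((\<lambda>x. d\<rho> x v) has_derivative (\<lambda>h. hess q h v)) (at q within M)" for v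
      by (rule d\<rho>_has_derivative[OF qU])
  qed (use q linear_d\<rho> linear_hess_right in auto)
  from tangential_derivative_unique[OF this has_derivative_const[of 0] V _ Z h]
  show ?thesis using q by simp
qed

end

section \<open>The Levi form and Lie brackets\<close>

lemma fst_cscale [simp]: "fst (cscale c v) = Re c *\<^sub>R fst v - Im c *\<^sub>R snd v"
  and snd_cscale [simp]: "snd (cscale c v) = Re c *\<^sub>R snd v + Im c *\<^sub>R fst v"
  by (simp_all add: cscale_def)

lemma fst_cconj [simp]: "fst (cconj v) = fst v"
  and snd_cconj [simp]: "snd (cconj v) = - snd v"
  by (simp_all add: cconj_def)

lemma cconj_cconj [simp]: "cconj (cconj v) = v"
  by (simp add: cconj_def)

lemma local_section_differentiable:
  assumes "local_section M p V L" "open U" "p \<in> U"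
  obtains W where "open W" "p \<in> W" "W \<subseteq> U" "\<And>x. x \<in> M \<inter> W \<Longrightarrow> L x \<in> V x"
    "\<And>x. x \<in> M \<inter> W \<Longrightarrow> L differentiable (at x within M)"
proof -
  obtain W where W: "open W" "p \<in> W" "smooth_map_on (M \<inter> W) L" "\<forall>x\<in>M \<inter> W. L x \<in> V x"
    using assms(1) unfolding local_section_def by blast
  show ?thesis
  proof (rule that[of "W \<inter> U"])
    fix x assume x: "x \<in> M \<inter> (W \<inter> U)"
    have "at x within M \<inter> W = at x within M"
      using x W(1) by (intro at_within_nhd[of x W]) auto
    then show "L differentiable (at x within M)"
      using smooth_map_on_differentiable[OF W(3), of x] x by auto
    show "L x \<in> V x" using x W by blast
  qed (use W assms in auto)
qed

context hypersurface_chart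
begin

text \<open>The exterior derivative of \<open>d\<rho> \<circ> J\<close> up to sign: on sections \<open>X\<close>, \<open>Y\<close> of the complex tangent bundle it is
the value of \<open>d\<rho> \<circ> J\<close> on \<open>[X, Y]\<close>.\<close>

definition levi_real :: "complex ^ 'n \<Rightarrow> complex ^ 'n \<Rightarrow> complex ^ 'n \<Rightarrow> real" where
  "levi_real q u v = hess q v (J u) - hess q u (J v)"

text \<open>The complex bilinear extension of \<open>levi_real\<close>; it is defined at all points of \<open>U\<close> and on all
vectors, so that it can be differentiated freely.\<close>

definition levi :: "complex ^ 'n \<Rightarrow> (complex ^ 'n) cplx \<Rightarrow> (complex ^ 'n) cplx \<Rightarrow> complex" where
  "levi q v w = of_real (levi_real q (fst v) (fst w) - levi_real q (snd v) (snd w))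
     + \<i> * of_real (levi_real q (fst v) (snd w) + levi_real q (snd v) (fst w))"

lemma levi_real_simps:
  assumes "q \<in> U"
  shows "levi_real q (u + u') v = levi_real q u v + levi_real q u' v"
    "levi_real q (u - u') v = levi_real q u v - levi_real q u' v"
    "levi_real q (- u) v = - levi_real q u v"
    "levi_real q (c *\<^sub>R u) v = c * levi_real q u v"
    "levi_real q u (v + v') = levi_real q u v + levi_real q u v'"
    "levi_real q u (v - v') = levi_real q u v - levi_real q u v'"
    "levi_real q u (- v) = - levi_real q u v"
    "levi_real q u (c *\<^sub>R v) = c * levi_real q u v"
  using assms by (simp_all add: levi_real_def hess_simps J_simps algebra_simps)

lemma levi_antisym: "levi q v w = - levi q w v"
  by (simp add: levi_def levi_real_def complex_eq_iff)

lemma levi_complex_linear_left: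
  "q \<in> U \<Longrightarrow> levi q (cscale a u + cscale b v) w = a * levi q u w + b * levi q v w"
  by (simp add: levi_def complex_eq_iff levi_real_simps algebra_simps)

lemma levi_complex_linear_right:
  "q \<in> U \<Longrightarrow> levi q w (cscale a u + cscale b v) = a * levi q w u + b * levi q w v"
  using levi_complex_linear_left[of q a u b v w] by (simp add: levi_antisym[of q w])

lemma levi_cconj: "q \<in> U \<Longrightarrow> levi q (cconj v) (cconj w) = cnj (levi q v w)"
  by (simp add: levi_def complex_eq_iff levi_real_simps)

lemma linear_levi_left: "q \<in> U \<Longrightarrow> linear (\<lambda>v. levi q v w)"
  by (rule linearI) (simp_all add: levi_def complex_eq_iff levi_real_simps algebra_simps)

lemma linear_levi_right: "q \<in> U \<Longrightarrow> linear (levi q v)"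
  by (rule linearI) (simp_all add: levi_def complex_eq_iff levi_real_simps algebra_simps)

lemma levi_differentiable: "q \<in> U \<Longrightarrow> (\<lambda>x. levi x v w) differentiable (at q)"
proof -
  assume "q \<in> U"
  have h: "(\<lambda>x. hess x a b) differentiable (at q)" for a b
    using smooth_on_has_derivative[OF smooth_hess \<open>q \<in> U\<close>] by (auto simp: differentiable_def)
  have of: "(\<lambda>x. complex_of_real (f x)) differentiable (at q)" if "f differentiable (at q)" for f :: "complex ^ 'n \<Rightarrow> real"
    using that has_derivative_of_real unfolding differentiable_def by blast
  show ?thesis
    unfolding levi_def levi_real_def
    by (intro differentiable_add differentiable_mult differentiable_diff differentiable_const of h)
qed

text \<open>The two relations \<open>d\<rho> (L) = 0\<close> and \<open>d\<rho> (J L) = 0\<close> along \<open>M\<close>, and those for \<open>L'\<close>, are differentiated along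
the other field. In \<open>d\<rho> [L, L']\<close> the Hessian terms cancel by symmetry; in \<open>d\<rho> (J [L, L'])\<close> they combine
to the Levi form, so the bracket modulo \<open>CH\<close> depends on the values of \<open>L\<close> and \<open>L'\<close> only.\<close>

lemma lie_bracket_CH:
  assumes q: "q \<in> M \<inter> U" and V: "open V" "q \<in> V"
    and L: "\<And>x. x \<in> M \<inter> V \<Longrightarrow> L x \<in> CH M x" "L differentiable (at q within M)"
    and L': "\<And>x. x \<in> M \<inter> V \<Longrightarrow> L' x \<in> CH M x" "L' differentiable (at q within M)"
  shows "lie_bracket M L L' q \<in> CT M q"
    and "cpair (\<lambda>v. d\<rho> q (J v)) (lie_bracket M L L' q) = levi q (L q) (L' q)"
proof -
  have qU: "q \<in> U" using q by blast
  have D: "d\<rho> q (fst (D u)) = - hess q u (fst (N q)) \<and> d\<rho> q (J (fst (D u))) = - hess q u (J (fst (N q))) \<and>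
      d\<rho> q (snd (D u)) = - hess q u (snd (N q)) \<and> d\<rho> q (J (snd (D u))) = - hess q u (J (snd (N q)))"
    if N: "\<forall>x\<in>M \<inter> V. N x \<in> CH M x" and "N differentiable (at q within M)"
      and D: "D = frechet_derivative N (at q within M)" and u: "u \<in> tangent_space M q" for N D u
  proof -
    have D: "(N has_derivative D) (at q within M)"
      using that frechet_derivative_works by blast
    have VU: "open (V \<inter> U)" "q \<in> V \<inter> U" using V open_U qU by auto
    note ann = derivative_of_annihilated[OF q VU _ _ u]
    have "d\<rho> x (fst (N x)) = 0" "d\<rho> x (J (fst (N x))) = 0" "d\<rho> x (snd (N x)) = 0"
      "d\<rho> x (J (snd (N x))) = 0" if "x \<in> M \<inter> (V \<inter> U)" for x
      using N CH_iff[of x "N x"] that by auto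
    then show ?thesis
      by (intro conjI ann has_derivative_fst has_derivative_snd has_derivative_J D)
  qed
  have T: "fst (L q) \<in> tangent_space M q" "snd (L q) \<in> tangent_space M q"
    "fst (L' q) \<in> tangent_space M q" "snd (L' q) \<in> tangent_space M q"
    using L(1)[of q] L'(1)[of q] q V by (auto simp: tangent_space_iff CH_iff)
  have "\<forall>x\<in>M \<inter> V. L x \<in> CH M x" "\<forall>x\<in>M \<inter> V. L' x \<in> CH M x" using L(1) L'(1) by blast+
  note DL = D[OF this(1) L(2) refl] and DL' = D[OF this(2) L'(2) refl]
  show "lie_bracket M L L' q \<in> CT M q"
    using q qU DL[OF T(3)] DL[OF T(4)] DL'[OF T(1)] DL'[OF T(2)]
      hess_symmetric[OF qU, of "fst (L q)" "fst (L' q)"] hess_symmetric[OF qU, of "snd (L q)" "snd (L' q)"]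
      hess_symmetric[OF qU, of "fst (L q)" "snd (L' q)"] hess_symmetric[OF qU, of "snd (L q)" "fst (L' q)"]
    by (simp add: CT_iff lie_bracket_def deriv_field_def d\<rho>_simps)
  show "cpair (\<lambda>v. d\<rho> q (J v)) (lie_bracket M L L' q) = levi q (L q) (L' q)"
    using q qU DL[OF T(3)] DL[OF T(4)] DL'[OF T(1)] DL'[OF T(2)]
    by (simp add: cpair_def lie_bracket_def deriv_field_def d\<rho>_simps J_simps
        complex_eq_iff levi_def levi_real_def)
qed

lemma CH_subspace:
  assumes "q \<in> M \<inter> U" "u \<in> CH M q" "v \<in> CH M q"
  shows "cscale a u + cscale b v \<in> CH M q"
  using assms by (auto simp: CH_iff d\<rho>_simps J_simps)

lemma H10_subspace:
  assumes "q \<in> M \<inter> U" "u \<in> H10 M q" "v \<in> H10 M q"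
  shows "cscale a u + cscale b v \<in> H10 M q"
  using CH_subspace[OF assms(1)] assms by (auto simp: H10_iff J_simps algebra_simps)

lemma H10_bar_subspace:
  assumes "q \<in> M \<inter> U" "u \<in> H10_bar M q" "v \<in> H10_bar M q"
  shows "cscale a u + cscale b v \<in> H10_bar M q"
  using CH_subspace[OF assms(1)] assms by (auto simp: H10_bar_iff J_simps algebra_simps)

end

section \<open>Extending vectors to sections\<close>

text \<open>The vector \<open>e\<close> spans the tangent space at \<open>p\<close> modulo the complex tangent space, and \<open>J e\<close> is transversal
to \<open>M\<close>. Near \<open>p\<close> both are used as fixed directions along which to project.\<close>

locale hypersurface_point = hypersurface_chart M U \<rho>
  for M U :: "(complex ^ 'n) set" and \<rho> +
  fixes p e :: "complex ^ 'n"
  assumes p: "p \<in> M \<inter> U" and e: "d\<rho> p e = 0" "d\<rho> p (J e) = 1"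
begin

lemma p_U: "p \<in> U" using p by blast
lemma p_M: "p \<in> M" using p by blast

text \<open>Projection along \<open>J e\<close> onto the kernel of \<open>d\<rho>\<close>, multiplied by \<open>d\<rho> (J e)\<close>. With this factor the formula
is polynomial in the coefficients of \<open>d\<rho>\<close>, hence smooth on all of \<open>U\<close>; at \<open>p\<close> the factor is \<open>1\<close>.\<close>

definition tan_field :: "complex ^ 'n \<Rightarrow> complex ^ 'n \<Rightarrow> complex ^ 'n" where
  "tan_field X q = d\<rho> q (J e) *\<^sub>R X - d\<rho> q X *\<^sub>R J e"

text \<open>The analogue over the complex numbers: with \<open>\<partial> v = d\<rho> v - \<i> d\<rho> (J v)\<close>, whose kernel is the complex
tangent space, this is \<open>\<partial> (J e) X - \<partial> X (J e)\<close> written out in real terms.\<close>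

definition hol_field :: "complex ^ 'n \<Rightarrow> complex ^ 'n \<Rightarrow> complex ^ 'n" where
  "hol_field X q = d\<rho> q (J e) *\<^sub>R X + d\<rho> q e *\<^sub>R J X - d\<rho> q X *\<^sub>R J e - d\<rho> q (J X) *\<^sub>R e"

text \<open>Extends a vector of \<open>CH\<close> at \<open>p\<close> to a section near \<open>p\<close>. The extension is complex linear in the vector and
commutes with conjugation, and these properties pass on to the cubic form built from it.\<close>

definition hol_lift :: "(complex ^ 'n) cplx \<Rightarrow> complex ^ 'n \<Rightarrow> (complex ^ 'n) cplx" where
  "hol_lift v q = (hol_field (fst v) q, hol_field (snd v) q)"

lemma d\<rho>_tan_field: "q \<in> U \<Longrightarrow> d\<rho> q (tan_field X q) = 0"
  by (simp add: tan_field_def d\<rho>_simps)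

lemma hol_field_J: "q \<in> U \<Longrightarrow> hol_field (J X) q = J (hol_field X q)"
  by (simp add: hol_field_def d\<rho>_simps J_simps)

lemma d\<rho>_hol_field: "q \<in> U \<Longrightarrow> d\<rho> q (hol_field X q) = 0" "q \<in> U \<Longrightarrow> d\<rho> q (J (hol_field X q)) = 0"
  by (simp_all add: hol_field_def d\<rho>_simps J_simps)

lemma hol_field_p: "d\<rho> p X = 0 \<Longrightarrow> d\<rho> p (J X) = 0 \<Longrightarrow> hol_field X p = X"
  by (simp add: hol_field_def e)

lemma hol_field_linear: "q \<in> U \<Longrightarrow> linear (\<lambda>X. hol_field X q)"
  by (rule linearI) (simp_all add: hol_field_def d\<rho>_simps J_simps algebra_simps)

lemmas hol_field_simps = linear_add[OF hol_field_linear] linear_diff[OF hol_field_linear] linear_neg[OF hol_field_linear]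
  linear_scale[OF hol_field_linear]

lemma smooth_tan_field: "smooth_on U (tan_field X)"
  unfolding tan_field_def
  by (intro smooth_on_diff smooth_on_scaleR smooth_d\<rho> smooth_on_const open_U)

lemma smooth_hol_field: "smooth_on U (hol_field X)"
  unfolding hol_field_def
  by (intro smooth_on_diff smooth_on_add smooth_on_scaleR smooth_d\<rho> smooth_on_const open_U)

lemma smooth_hol_lift: "smooth_on U (hol_lift v)"
  unfolding hol_lift_def by (intro smooth_on_Pair smooth_hol_field open_U)

lemma hol_lift_CH: "q \<in> M \<inter> U \<Longrightarrow> hol_lift v q \<in> CH M q"
  by (simp add: CH_iff hol_lift_def d\<rho>_hol_field)

lemma hol_lift_p: "v \<in> CH M p \<Longrightarrow> hol_lift v p = v"
  using p by (simp add: CH_iff hol_lift_def hol_field_p)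

lemma hol_lift_complex_linear: "q \<in> U \<Longrightarrow> hol_lift (cscale a u + cscale b v) q = cscale a (hol_lift u q) + cscale b (hol_lift v q)"
  by (simp add: hol_lift_def prod_eq_iff hol_field_simps)

lemma hol_lift_cconj: "q \<in> U \<Longrightarrow> hol_lift (cconj v) q = cconj (hol_lift v q)"
  by (simp add: hol_lift_def prod_eq_iff hol_field_simps)

lemma hol_lift_H10: "v \<in> H10 M p \<Longrightarrow> q \<in> M \<inter> U \<Longrightarrow> hol_lift v q \<in> H10 M q"
  by (auto simp: H10_iff hol_lift_CH) (auto simp: hol_lift_def hol_field_simps hol_field_J)

lemma hol_lift_H10_bar: "v \<in> H10_bar M p \<Longrightarrow> q \<in> M \<inter> U \<Longrightarrow> hol_lift v q \<in> H10_bar M q"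
  using p by (auto simp: H10_bar_iff hol_lift_CH) (auto simp: hol_lift_def hol_field_simps hol_field_J)

lemma smooth_local_section:
  assumes "smooth_on U L" "\<And>q. q \<in> M \<inter> U \<Longrightarrow> L q \<in> V q"
  shows "local_section M p V L"
  using assms open_U p_U unfolding local_section_def smooth_map_on_def by blast

lemma CT_local_section_exists:
  assumes "v \<in> CT M p"
  shows "\<exists>L. local_section M p (CT M) L \<and> L p = v"
proof -
  let ?L = "\<lambda>q. (tan_field (fst v) q, tan_field (snd v) q)"
  have "local_section M p (CT M) ?L"
    by (rule smooth_local_section)
       (auto intro!: smooth_on_Pair smooth_tan_field open_U simp: CT_iff d\<rho>_tan_field)
  moreover have "?L p = v" using assms p by (simp add: CT_iff tan_field_def e)
  ultimately show ?thesis by blast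
qed

section \<open>Contact forms\<close>

text \<open>The form \<open>d\<rho> \<circ> J\<close> vanishes on the complex tangent bundle, but it is only defined near \<open>p\<close>; a bump
function supported in \<open>U\<close> extends it by zero.\<close>

lemma contact_form_exists: "\<exists>\<theta>. contact_form M \<theta> \<and> \<theta> p e \<noteq> 0"
proof -
  obtain r where r: "r > 0" "cball p r \<subseteq> U"
    using open_U p_U open_contains_cball by blast
  obtain \<phi> :: "complex ^ 'n \<Rightarrow> real" where \<phi>: "smooth_on UNIV \<phi>" "\<phi> p > 0" "\<And>x. r \<le> dist p x \<Longrightarrow> \<phi> x = 0"
    using smooth_bump[OF r(1), of p] by metis
  define \<theta> where "\<theta> q v = \<phi> q * d\<rho> q (J v)" for q v
  have out: "\<theta> q v = 0" if "q \<notin> cball p r" for q v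
    using that \<phi>(3)[of q] by (simp add: \<theta>_def)
  have "linear (\<theta> q)" for q
  proof (cases "q \<in> U")
    case True
    then show ?thesis
      by (intro linearI) (simp_all add: \<theta>_def d\<rho>_simps J_simps algebra_simps)
  next
    case False
    then have "\<theta> q = (\<lambda>_. 0)" using out r by blast
    then show ?thesis by (simp add: linear_iff)
  qed
  moreover have "smooth_map_on M (\<lambda>q. \<theta> q v)" for v
    unfolding smooth_map_on_def
  proof
    fix x assume "x \<in> M"
    show "\<exists>W g. open W \<and> x \<in> W \<and> smooth_on W g \<and> (\<forall>y\<in>M \<inter> W. g y = \<theta> y v)"
    proof (cases "x \<in> U")
      case True
      have "smooth_on U (\<lambda>q. \<theta> q v)"
        unfolding \<theta>_def
        by (intro smooth_on_mult open_U smooth_d\<rho> smooth_on_subset[OF \<phi>(1)]) auto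
      then show ?thesis using open_U True by blast
    next
      case False
      then have "x \<in> - cball p r" using r by blast
      moreover have "open (- cball p r)" by (simp add: open_Compl)
      ultimately show ?thesis
        using out smooth_on_const[of "- cball p r" "0::real"] by (metis ComplD IntD2)
    qed
  qed
  moreover have "\<theta> q v = 0" if "q \<in> M" "v \<in> complex_tangent_space M q" for q v
  proof (cases "q \<in> U")
    case True
    then show ?thesis using that complex_tangent_space_iff[of q v] by (simp add: \<theta>_def)
  next
    case False
    then show ?thesis using out r by blast
  qed
  ultimately have "contact_form M \<theta>" unfolding contact_form_def by blast
  moreover have "\<theta> p e \<noteq> 0" using \<phi>(2) e by (simp add: \<theta>_def)
  ultimately show ?thesis by blast
qed

text \<open>The quotient of the tangent space by the complex tangent space is a line, so \<open>\<theta>\<close> and \<open>d\<rho> \<circ> J\<close> are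
proportional on it. The field \<open>tan_field e\<close>, which does not lie in the complex tangent space near \<open>p\<close>,
gives the ratio as a differentiable function.\<close>

lemma contact_form_proportional:
  assumes \<theta>: "contact_form M \<theta>" and q: "q \<in> M \<inter> U" and v: "d\<rho> q v = 0"
  shows "d\<rho> q (J (tan_field e q)) * \<theta> q v = \<theta> q (tan_field e q) * d\<rho> q (J v)"
proof -
  have qU: "q \<in> U" using q by blast
  let ?E = "tan_field e q"
  \<comment> \<open>the combination of \<open>v\<close> and \<open>?E\<close> that \<open>d\<rho> \<circ> J\<close> annihilates, hence a complex tangent vector\<close>
  let ?z = "d\<rho> q (J ?E) *\<^sub>R v - d\<rho> q (J v) *\<^sub>R ?E"
  have "?z \<in> complex_tangent_space M q"
    using q qU v by (simp add: complex_tangent_space_iff d\<rho>_simps J_simps d\<rho>_tan_field)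
  then have "\<theta> q ?z = 0" "linear (\<theta> q)"
    using \<theta> q unfolding contact_form_def by blast+
  then show ?thesis by (simp add: linear_diff linear_scale mult.commute)
qed

section \<open>The cubic form\<close>

text \<open>The rule for linear families, applied in the two arguments of \<open>levi\<close> in turn.\<close>

lemma levi_along_has_derivative:
  assumes S: "p \<in> S" and V: "(V has_derivative V') (at p within S)" and W: "(W has_derivative W') (at p within S)"
  shows "((\<lambda>x. levi x (V x) (W x)) has_derivative
    (\<lambda>h. levi p (V' h) (W p) + levi p (V p) (W' h) + dd (\<lambda>x. levi x (V p) (W p)) h p)) (at p within S)"
proof -
  have near: "\<forall>\<^sub>F x in at p within S. x \<in> U"
    using open_U p_U by (auto simp: eventually_at_topological)
  have fixed: "((\<lambda>x. levi x v w) has_derivative (\<lambda>h. dd (\<lambda>x. levi x v w) h p)) (at p within S)" for v w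
    using levi_differentiable[OF p_U] frechet_derivative_works by (blast intro: has_derivative_at_withinI)
  have inner: "((\<lambda>x. levi x v (W x)) has_derivative
      (\<lambda>h. levi p v (W' h) + dd (\<lambda>x. levi x v (W p)) h p)) (at p within S)" for v
  proof (rule has_derivative_linear_family[where f = "\<lambda>x. levi x v"
        and f' = "\<lambda>w h. dd (\<lambda>x. levi x v w) h p", OF S _ _ _ fixed W])
    show "\<forall>\<^sub>F x in at p within S. linear (levi x v)"
      using near by eventually_elim (rule linear_levi_right)
    show "linear (levi p v)" by (rule linear_levi_right[OF p_U])
    show "linear (\<lambda>w. dd (\<lambda>x. levi x v w) h p)" for h
      by (intro linear_frechet_derivative_family[OF open_U p_U] linear_levi_right levi_differentiable p_U)
  qed
  have "((\<lambda>x. levi x (V x) (W x)) has_derivative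
      (\<lambda>h. levi p (V' h) (W p) + (levi p (V p) (W' h) + dd (\<lambda>x. levi x (V p) (W p)) h p))) (at p within S)"
  proof (rule has_derivative_linear_family[where f = "\<lambda>x v. levi x v (W x)"
        and f' = "\<lambda>v h. levi p v (W' h) + dd (\<lambda>x. levi x v (W p)) h p", OF S _ _ _ inner V])
    show "\<forall>\<^sub>F x in at p within S. linear (\<lambda>v. levi x v (W x))"
      using near by eventually_elim (rule linear_levi_left)
    show "linear (\<lambda>v. levi p v (W p))" by (rule linear_levi_left[OF p_U])
    show "linear (\<lambda>v. levi p v (W' h) + dd (\<lambda>x. levi x v (W p)) h p)" for h
      by (intro linear_compose_add linear_levi_left p_U linear_frechet_derivative_family[OF open_U p_U]
          levi_differentiable)
  qed
  then show ?thesis by (simp add: add.assoc)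
qed

text \<open>The derivative of \<open>\<langle>d\<rho> \<circ> J, [L\<^sup>2, L\<^sup>1]\<rangle>\<close> in a real direction, for the extensions \<open>hol_lift\<close> of two given
vectors.\<close>

definition cubic_real_dir :: "complex ^ 'n \<Rightarrow> (complex ^ 'n) cplx \<Rightarrow> (complex ^ 'n) cplx \<Rightarrow> complex" where
  "cubic_real_dir h v w = dd (\<lambda>x. levi x (hol_lift v x) (hol_lift w x)) h p"

definition cubic :: "(complex ^ 'n) cplx \<Rightarrow> (complex ^ 'n) cplx \<Rightarrow> (complex ^ 'n) cplx \<Rightarrow> complex" where
  "cubic h v w = cubic_real_dir (fst h) v w + \<i> * cubic_real_dir (snd h) v w"

lemma hol_lift_has_derivative: "(hol_lift v has_derivative (\<lambda>h. dd (hol_lift v) h p)) (at p within S)"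
  using smooth_on_has_derivative[OF smooth_hol_lift p_U] by (blast intro: has_derivative_at_withinI)

lemma cubic_real_dir_has_derivative:
  "((\<lambda>x. levi x (hol_lift v x) (hol_lift w x)) has_derivative (\<lambda>h. cubic_real_dir h v w)) (at p within S)"
proof -
  have "(\<lambda>x. levi x (hol_lift v x) (hol_lift w x)) differentiable (at p)"
    using levi_along_has_derivative[OF UNIV_I hol_lift_has_derivative hol_lift_has_derivative]
    unfolding differentiable_def by blast
  then show ?thesis
    unfolding cubic_real_dir_def frechet_derivative_works by (rule has_derivative_at_withinI)
qed

lemma linear_cubic_real_dir: "linear (\<lambda>h. cubic_real_dir h v w)"
  using cubic_real_dir_has_derivative has_derivative_linear by blast

lemma cubic_real_dir_complex_linear_left:
  "cubic_real_dir h (cscale a u + cscale b v) w = a * cubic_real_dir h u w + b * cubic_real_dir h v w"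
proof -
  have "((\<lambda>x. a * levi x (hol_lift u x) (hol_lift w x) + b * levi x (hol_lift v x) (hol_lift w x)) has_derivative
      (\<lambda>h. a * cubic_real_dir h u w + b * cubic_real_dir h v w)) (at p)"
    by (intro has_derivative_add has_derivative_mult_right cubic_real_dir_has_derivative)
  then have "((\<lambda>x. levi x (hol_lift (cscale a u + cscale b v) x) (hol_lift w x)) has_derivative
      (\<lambda>h. a * cubic_real_dir h u w + b * cubic_real_dir h v w)) (at p)"
    by (rule has_derivative_transform_within_open[OF _ open_U p_U])
       (simp add: hol_lift_complex_linear levi_complex_linear_left)
  from has_derivative_unique[OF this cubic_real_dir_has_derivative] show ?thesis by metis
qed

lemma cubic_real_dir_antisym: "cubic_real_dir h v w = - cubic_real_dir h w v"
proof -
  have "((\<lambda>x. - levi x (hol_lift w x) (hol_lift v x)) has_derivative (\<lambda>h. - cubic_real_dir h w v)) (at p)"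
    by (intro has_derivative_minus cubic_real_dir_has_derivative)
  then have "((\<lambda>x. levi x (hol_lift v x) (hol_lift w x)) has_derivative (\<lambda>h. - cubic_real_dir h w v)) (at p)"
    by (simp add: levi_antisym[of _ "hol_lift w _"])
  from has_derivative_unique[OF this cubic_real_dir_has_derivative] show ?thesis by metis
qed

lemma cubic_real_dir_cconj: "cubic_real_dir h (cconj v) (cconj w) = cnj (cubic_real_dir h v w)"
proof -
  have "((\<lambda>x. cnj (levi x (hol_lift v x) (hol_lift w x))) has_derivative (\<lambda>h. cnj (cubic_real_dir h v w))) (at p)"
    by (intro has_derivative_cnj cubic_real_dir_has_derivative)
  then have "((\<lambda>x. levi x (hol_lift (cconj v) x) (hol_lift (cconj w) x)) has_derivative
      (\<lambda>h. cnj (cubic_real_dir h v w))) (at p)"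
    by (rule has_derivative_transform_within_open[OF _ open_U p_U])
       (simp add: hol_lift_cconj levi_cconj)
  from has_derivative_unique[OF this cubic_real_dir_has_derivative] show ?thesis by metis
qed

lemma cubic_complex_linear:
  "cubic (cscale a h + cscale b k) v w = a * cubic h v w + b * cubic k v w"
  "cubic h (cscale a u + cscale b v) w = a * cubic h u w + b * cubic h v w"
  "cubic h w (cscale a u + cscale b v) = a * cubic h w u + b * cubic h w v"
proof -
  show "cubic (cscale a h + cscale b k) v w = a * cubic h v w + b * cubic k v w"
    by (simp add: cubic_def linear_add[OF linear_cubic_real_dir] linear_diff[OF linear_cubic_real_dir]
        linear_scale[OF linear_cubic_real_dir] complex_eq_iff algebra_simps)
  show 2: "cubic h (cscale a u + cscale b v) w = a * cubic h u w + b * cubic h v w" for h w u v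
    by (simp add: cubic_def cubic_real_dir_complex_linear_left algebra_simps)
  have anti: "cubic h x y = - cubic h y x" for x y
    by (simp add: cubic_def cubic_real_dir_antisym[of _ x y])
  show "cubic h w (cscale a u + cscale b v) = a * cubic h w u + b * cubic h w v"
    using 2[of h u v w] by (simp add: anti[of w "cscale a u + cscale b v"] anti[of w u] anti[of w v])
qed

lemma cubic_cconj: "cnj (cubic h v w) = - cubic (cconj h) (cconj w) (cconj v)"
proof -
  have "cnj (cubic_real_dir k v w) = - cubic_real_dir k (cconj w) (cconj v)" for k
    by (metis cubic_real_dir_antisym cubic_real_dir_cconj)
  then show ?thesis by (simp add: cubic_def linear_neg[OF linear_cubic_real_dir])
qed

text \<open>A section \<open>L\<close> and the extension of its value at \<open>p\<close> differ by a section that vanishes at \<open>p\<close>. The relations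
defining the bundle then survive differentiation without Hessian terms, so the derivative of the
difference lies in the fibre at \<open>p\<close>. The constant \<open>c\<close> is \<open>-1\<close> for \<open>H10\<close> and \<open>1\<close> for \<open>H10_bar\<close>.\<close>

lemma section_derivative_difference:
  assumes V: "open V" "p \<in> V" and L: "\<And>x. x \<in> M \<inter> V \<Longrightarrow> L x \<in> CH M x \<and> snd (L x) = c *\<^sub>R J (fst (L x))"
    and L': "(L has_derivative L') (at p within M)" and h: "h \<in> tangent_space M p"
  shows "L' h - dd (hol_lift (L p)) h p \<in> CH M p \<and>
    snd (L' h - dd (hol_lift (L p)) h p) = c *\<^sub>R J (fst (L' h - dd (hol_lift (L p)) h p))"
proof -
  define N where "N x = L x - hol_lift (L p) x" for x
  define N' where "N' h = L' h - dd (hol_lift (L p)) h p" for h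
  have N': "(N has_derivative N') (at p within M)"
    unfolding N_def N'_def by (intro has_derivative_diff L' hol_lift_has_derivative)
  have VU: "open (V \<inter> U)" "p \<in> V \<inter> U" using V open_U p_U by auto
  have Lp: "L p \<in> CH M p" "snd (L p) = c *\<^sub>R J (fst (L p))" using L[of p] V p_M by auto
  have N0: "N p = 0" using hol_lift_p[OF Lp(1)] by (simp add: N_def)
  have lift_rel: "snd (hol_lift (L p) x) = c *\<^sub>R J (fst (hol_lift (L p) x))" if "x \<in> U" for x
    using that Lp(2) by (simp add: hol_lift_def hol_field_simps hol_field_J)
  have N: "d\<rho> x (fst (N x)) = 0" "d\<rho> x (J (fst (N x))) = 0" "d\<rho> x (snd (N x)) = 0"
    "d\<rho> x (J (snd (N x))) = 0" "snd (N x) = c *\<^sub>R J (fst (N x))" if "x \<in> M \<inter> (V \<inter> U)" for x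
  proof -
    have x: "x \<in> M \<inter> U" "x \<in> U" using that by auto
    show "d\<rho> x (fst (N x)) = 0" "d\<rho> x (J (fst (N x))) = 0" "d\<rho> x (snd (N x)) = 0"
      "d\<rho> x (J (snd (N x))) = 0"
      using L[of x] hol_lift_CH[OF x(1), of "L p"] that CH_iff[OF x(1)] x
      by (simp_all add: N_def d\<rho>_simps J_simps)
    show "snd (N x) = c *\<^sub>R J (fst (N x))"
      using L[of x] lift_rel[OF x(2)] that by (simp add: N_def J_simps algebra_simps)
  qed
  note ann = derivative_of_annihilated[OF p VU _ _ h]
  have "d\<rho> p (fst (N' h)) = - hess p h (fst (N p))" "d\<rho> p (J (fst (N' h))) = - hess p h (J (fst (N p)))"
    "d\<rho> p (snd (N' h)) = - hess p h (snd (N p))" "d\<rho> p (J (snd (N' h))) = - hess p h (J (snd (N p)))"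
    by (intro ann has_derivative_fst has_derivative_snd has_derivative_J N' N; simp)+
  then have "N' h \<in> CH M p"
    using p p_U by (simp add: CH_iff N0 hess_simps J_simps)
  moreover have "snd (N' h) = c *\<^sub>R J (fst (N' h))"
    by (rule tangential_derivative_unique[where f = "\<lambda>x. snd (N x)" and g = "\<lambda>x. c *\<^sub>R J (fst (N x))",
        OF _ _ VU p_M N(5) h])
       (auto intro!: has_derivative_fst has_derivative_snd has_derivative_J has_derivative_scaleR_right N')
  ultimately show ?thesis unfolding N'_def by blast
qed

text \<open>The heart of the matter, and the place where the Levi kernel enters. Replacing a section by the
extension of its value at \<open>p\<close> changes the derivative of \<open>levi x (L x) (N x)\<close> by the Levi form of a vector
of the fibre (by \<open>section_derivative_difference\<close>) against the value of the other section; this vanishes,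
because that value annihilates the fibre.\<close>

lemma levi_along_sections_derivative:
  assumes V: "open V" "p \<in> V"
    and L: "\<And>x. x \<in> M \<inter> V \<Longrightarrow> L x \<in> H10 M x" "(L has_derivative L') (at p within M)"
    and N: "\<And>x. x \<in> M \<inter> V \<Longrightarrow> N x \<in> H10_bar M x" "(N has_derivative N') (at p within M)"
    and kerL: "\<And>u. u \<in> H10_bar M p \<Longrightarrow> levi p (L p) u = 0"
    and kerN: "\<And>u. u \<in> H10 M p \<Longrightarrow> levi p u (N p) = 0"
  shows "\<exists>D. ((\<lambda>x. levi x (L x) (N x)) has_derivative D) (at p within M) \<and>
    (\<forall>h\<in>tangent_space M p. D h = cubic_real_dir h (L p) (N p))"
proof (intro exI conjI ballI)
  show D: "((\<lambda>x. levi x (L x) (N x)) has_derivative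
    (\<lambda>h. levi p (L' h) (N p) + levi p (L p) (N' h) + dd (\<lambda>x. levi x (L p) (N p)) h p)) (at p within M)"
    by (rule levi_along_has_derivative[OF p_M L(2) N(2)])
  fix h assume h: "h \<in> tangent_space M p"
  have LN: "L p \<in> H10 M p" "N p \<in> H10_bar M p" using L(1) N(1) V p_M by auto
  have secs: "hol_lift (L p) p = L p" "hol_lift (N p) p = N p"
    using LN p by (auto intro!: hol_lift_p simp: H10_iff H10_bar_iff)
  have VU: "open (V \<inter> U)" "p \<in> V \<inter> U" using V open_U p_U by auto
  have "L' h - dd (hol_lift (L p)) h p \<in> H10 M p"
    using section_derivative_difference[OF VU _ L(2) h, of "-1"] L(1) by (simp add: H10_iff)
  from kerN[OF this] have 1: "levi p (L' h) (N p) = levi p (dd (hol_lift (L p)) h p) (N p)"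
    by (simp add: linear_diff[OF linear_levi_left[OF p_U]])
  have "N x \<in> CH M x \<and> snd (N x) = 1 *\<^sub>R J (fst (N x))" if "x \<in> M \<inter> (V \<inter> U)" for x
    using N(1)[of x] H10_bar_iff[of x "N x"] that by auto
  from section_derivative_difference[OF VU this N(2) h] have "N' h - dd (hol_lift (N p)) h p \<in> H10_bar M p"
    using p by (simp add: H10_bar_iff)
  from kerL[OF this] have 2: "levi p (L p) (N' h) = levi p (L p) (dd (hol_lift (N p)) h p)"
    by (simp add: linear_diff[OF linear_levi_right[OF p_U]])
  note levi_along_has_derivative[OF UNIV_I hol_lift_has_derivative[of "L p"] hol_lift_has_derivative[of "N p"]]
  from fun_cong[OF has_derivative_unique[OF cubic_real_dir_has_derivative this], of h]
  have "cubic_real_dir h (L p) (N p) = levi p (dd (hol_lift (L p)) h p) (N p) + levi p (L p) (dd (hol_lift (N p)) h p)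
      + dd (\<lambda>x. levi x (L p) (N p)) h p"
    unfolding secs .
  then show "levi p (L' h) (N p) + levi p (L p) (N' h) + dd (\<lambda>x. levi x (L p) (N p)) h p
      = cubic_real_dir h (L p) (N p)"
    using 1 2 by simp
qed

definition contact_ratio :: "(complex ^ 'n \<Rightarrow> complex ^ 'n \<Rightarrow> real) \<Rightarrow> complex ^ 'n \<Rightarrow> real" where
  "contact_ratio \<theta> x = \<theta> x (tan_field e x) / d\<rho> x (J (tan_field e x))"

lemma tan_field_p: "tan_field e p = e"
  by (simp add: tan_field_def e)

lemma contact_ratio_p: "contact_ratio \<theta> p = \<theta> p e"
  by (simp add: contact_ratio_def tan_field_p e)

lemma contact_bracket:
  assumes \<theta>: "contact_form M \<theta>" and L: "local_section M p (H10 M) L" and N: "local_section M p (H10_bar M) N"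
  obtains W where "open W" "p \<in> W" "W \<subseteq> U"
    "\<And>x. x \<in> M \<inter> W \<Longrightarrow> cpair (\<theta> x) (lie_bracket M L N x) = contact_ratio \<theta> x * levi x (L x) (N x)"
    "\<And>x. x \<in> M \<inter> W \<Longrightarrow> L x \<in> H10 M x \<and> L differentiable (at x within M)"
    "\<And>x. x \<in> M \<inter> W \<Longrightarrow> N x \<in> H10_bar M x \<and> N differentiable (at x within M)"
proof -
  obtain W1 where W1: "open W1" "p \<in> W1" "W1 \<subseteq> U" "\<And>x. x \<in> M \<inter> W1 \<Longrightarrow> L x \<in> H10 M x"
    "\<And>x. x \<in> M \<inter> W1 \<Longrightarrow> L differentiable (at x within M)"
    using local_section_differentiable[OF L open_U p_U] by metis
  obtain W2 where W2: "open W2" "p \<in> W2" "W2 \<subseteq> W1" "\<And>x. x \<in> M \<inter> W2 \<Longrightarrow> N x \<in> H10_bar M x"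
    "\<And>x. x \<in> M \<inter> W2 \<Longrightarrow> N differentiable (at x within M)"
    using local_section_differentiable[OF N W1(1,2)] by metis
  \<comment> \<open>where \<open>d\<rho> (J e)\<close> is nonzero, the denominator of the contact ratio is positive\<close>
  define W where "W = W2 \<inter> (\<lambda>x. d\<rho> x (J e)) -` (- {0}) \<inter> U"
  have "open ((\<lambda>x. d\<rho> x (J e)) -` (- {0}) \<inter> U)"
    using continuous_on_open_vimage[OF open_U, THEN iffD1, OF smooth_on_continuous[OF smooth_d\<rho>]]
    by blast
  then have W: "open W" "p \<in> W" "W \<subseteq> W2" "W \<subseteq> U" "W \<subseteq> W1"
    using W2 W1 p_U e unfolding W_def by (auto intro: open_Int simp: Int_assoc)
  show ?thesis
  proof (rule that[OF W(1,2,4)])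
    fix x assume x: "x \<in> M \<inter> W"
    then have xU: "x \<in> U" "x \<in> M \<inter> U" "x \<in> M \<inter> W2" "x \<in> M \<inter> W1" using W by auto
    show "L x \<in> H10 M x \<and> L differentiable (at x within M)"
      "N x \<in> H10_bar M x \<and> N differentiable (at x within M)"
      using W1 W2 xU by auto
    have LC: "L y \<in> CH M y" "N y \<in> CH M y" if "y \<in> M \<inter> W" for y
      using that W W1(4)[of y] W2(4)[of y] H10_bar_iff[of y "N y"] by (auto simp: H10_iff)
    note br = lie_bracket_CH[OF xU(2) W(1) _ LC(1) W1(5)[OF xU(4)] LC(2) W2(5)[OF xU(3)]]
    have T: "lie_bracket M L N x \<in> CT M x"
      and A: "cpair (\<lambda>v. d\<rho> x (J v)) (lie_bracket M L N x) = levi x (L x) (N x)"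
      using br x by auto
    have "d\<rho> x (J (tan_field e x)) = d\<rho> x (J e) * d\<rho> x (J e) + d\<rho> x e * d\<rho> x e"
      using xU by (simp add: tan_field_def d\<rho>_simps J_simps)
    moreover have "d\<rho> x (J e) \<noteq> 0" using x by (auto simp: W_def)
    ultimately have nz: "d\<rho> x (J (tan_field e x)) \<noteq> 0"
      by (metis add_nonneg_eq_0_iff mult_eq_0_iff zero_le_square)
    have "\<theta> x v = contact_ratio \<theta> x * d\<rho> x (J v)" if "d\<rho> x v = 0" for v
      using contact_form_proportional[OF \<theta> xU(2) that] nz by (simp add: contact_ratio_def field_simps)
    then have "cpair (\<theta> x) (lie_bracket M L N x) = contact_ratio \<theta> x * cpair (\<lambda>v. d\<rho> x (J v)) (lie_bracket M L N x)"
      using T xU(2) by (simp add: CT_iff cpair_def complex_eq_iff)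
    then show "cpair (\<theta> x) (lie_bracket M L N x) = contact_ratio \<theta> x * levi x (L x) (N x)"
      using A by simp
  qed
qed

lemma contact_ratio_differentiable:
  assumes "contact_form M \<theta>"
  shows "contact_ratio \<theta> differentiable (at p within M)"
proof -
  have t: "(\<lambda>x. \<theta> x v) differentiable (at p within M)" for v
    using assms p_M smooth_map_on_differentiable unfolding contact_form_def by blast
  have d: "(\<lambda>x. d\<rho> x v) differentiable (at p within M)" for v
    using d\<rho>_has_derivative[OF p_U] unfolding differentiable_def by blast
  let ?num = "\<lambda>x. d\<rho> x (J e) * \<theta> x e - d\<rho> x e * \<theta> x (J e)"
  let ?den = "\<lambda>x. d\<rho> x (J e) * d\<rho> x (J e) + d\<rho> x e * d\<rho> x e"
  have "(\<lambda>x. ?num x / ?den x) differentiable (at p within M)"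
    by (intro differentiable_divide differentiable_diff differentiable_add differentiable_mult t d)
       (simp add: e)
  then obtain D where D: "((\<lambda>x. ?num x / ?den x) has_derivative D) (at p within M)"
    unfolding differentiable_def by blast
  have "(contact_ratio \<theta> has_derivative D) (at p within M)"
  proof (rule has_derivative_transform_eventually[OF D _ _ p_M])
    have eq: "?num x / ?den x = contact_ratio \<theta> x" if "x \<in> M \<inter> U" for x
    proof -
      have "linear (\<theta> x)" "x \<in> U" using assms that unfolding contact_form_def by auto
      then show ?thesis
        by (simp add: contact_ratio_def tan_field_def linear_diff linear_scale d\<rho>_simps J_simps)
    qed
    show "\<forall>\<^sub>F x in at p within M. ?num x / ?den x = contact_ratio \<theta> x"
      using open_U p_U eq by (auto simp: eventually_at_topological)
    show "?num p / ?den p = contact_ratio \<theta> p" by (rule eq[OF p])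
  qed
  then show ?thesis unfolding differentiable_def by blast
qed

section \<open>The quotient modulo the complex tangent space\<close>

abbreviation \<alpha> :: "complex ^ 'n \<Rightarrow> real" where
  "\<alpha> v \<equiv> d\<rho> p (J v)"

text \<open>An element of \<open>CQ\<close>, described by the common value of \<open>d\<rho> \<circ> J\<close> on its representatives instead of by
one representative. In this form the operations on cosets become those of complex numbers.\<close>

definition coset :: "complex \<Rightarrow> (complex ^ 'n) cplx set" where
  "coset z = {v \<in> CT M p. cpair \<alpha> v = z}"

lemma CH_eq_coset_0: "CH M p = coset 0"
  using p by (auto simp: coset_def CH_iff CT_iff cpair_def complex_eq_iff)

lemma cpair_\<alpha>_add: "cpair \<alpha> (u + v) = cpair \<alpha> u + cpair \<alpha> v"
  and cpair_\<alpha>_diff: "cpair \<alpha> (u - v) = cpair \<alpha> u - cpair \<alpha> v"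
  and cpair_\<alpha>_scale: "cpair \<alpha> (cscale a u) = a * cpair \<alpha> u"
  by (simp_all add: cpair_def complex_eq_iff d\<rho>_simps J_simps p_U)

lemma CT_add: "u \<in> CT M p \<Longrightarrow> v \<in> CT M p \<Longrightarrow> u + v \<in> CT M p"
  and CT_diff: "u \<in> CT M p \<Longrightarrow> v \<in> CT M p \<Longrightarrow> u - v \<in> CT M p"
  and CT_scale: "u \<in> CT M p \<Longrightarrow> cscale a u \<in> CT M p"
  and CT_cconj: "u \<in> CT M p \<Longrightarrow> cconj u \<in> CT M p"
  using p p_U by (simp_all add: CT_iff d\<rho>_simps)

lemmas CT_closed = CT_add CT_diff CT_scale CT_cconj
lemmas cpair_\<alpha>_simps = cpair_\<alpha>_add cpair_\<alpha>_diff cpair_\<alpha>_scale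

lemma coset_representative: "cscale z (e, 0) \<in> coset z"
  using p by (simp add: coset_def CT_iff cpair_def d\<rho>_simps J_simps e complex_eq_iff)

lemma translate_eq_coset:
  assumes "v \<in> CT M p"
  shows "{v + h |h. h \<in> CH M p} = coset (cpair \<alpha> v)"
proof (intro subset_antisym subsetI)
  fix w assume "w \<in> {v + h |h. h \<in> CH M p}"
  then obtain h where "w = v + h" "h \<in> coset 0" unfolding CH_eq_coset_0 by blast
  then show "w \<in> coset (cpair \<alpha> v)"
    using assms by (simp add: coset_def CT_closed cpair_\<alpha>_simps)
next
  fix w assume "w \<in> coset (cpair \<alpha> v)"
  then have "w - v \<in> CH M p"
    using assms by (simp add: CH_eq_coset_0 coset_def CT_closed cpair_\<alpha>_simps)
  moreover have "w = v + (w - v)" by simp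
  ultimately show "w \<in> {v + h |h. h \<in> CH M p}" by blast
qed

lemma CQ_eq_range_coset: "CQ M p = range coset"
proof -
  have "\<exists>v\<in>CT M p. coset z = coset (cpair \<alpha> v)" for z
  proof
    show "cscale z (e, 0) \<in> CT M p" "coset z = coset (cpair \<alpha> (cscale z (e, 0)))"
      using coset_representative[of z] by (simp_all add: coset_def)
  qed
  moreover have "CQ M p = {coset (cpair \<alpha> v) |v. v \<in> CT M p}"
    unfolding CQ_def using translate_eq_coset by blast
  ultimately show ?thesis by blast
qed

lemma cq_plus_coset: "cq_plus (coset a) (coset b) = coset (a + b)"
proof (intro subset_antisym subsetI)
  fix w assume w: "w \<in> coset (a + b)"
  have "w = cscale a (e, 0) + (w - cscale a (e, 0))" by simp
  moreover have "w - cscale a (e, 0) \<in> coset b"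
    using w coset_representative[of a] by (simp add: coset_def CT_closed cpair_\<alpha>_simps)
  ultimately show "w \<in> cq_plus (coset a) (coset b)"
    using coset_representative[of a] unfolding cq_plus_def by blast
next
  fix w assume "w \<in> cq_plus (coset a) (coset b)"
  then obtain u v where "w = u + v" "u \<in> coset a" "v \<in> coset b" unfolding cq_plus_def by blast
  then show "w \<in> coset (a + b)" by (simp add: coset_def CT_closed cpair_\<alpha>_simps)
qed

lemma cq_scale_coset: "cq_scale M p c (coset a) = coset (c * a)"
proof (intro subset_antisym subsetI)
  fix w assume w: "w \<in> coset (c * a)"
  let ?r = "cscale a (e, 0)"
  have "w = cscale c ?r + (w - cscale c ?r)" by simp
  moreover have "w - cscale c ?r \<in> CH M p"
    using w coset_representative[of a] by (simp add: CH_eq_coset_0 coset_def CT_closed cpair_\<alpha>_simps)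
  ultimately show "w \<in> cq_scale M p c (coset a)"
    using coset_representative[of a] unfolding cq_scale_def by blast
next
  fix w assume "w \<in> cq_scale M p c (coset a)"
  then obtain u v where "w = cscale c u + v" "u \<in> coset a" "v \<in> coset 0"
    unfolding cq_scale_def CH_eq_coset_0 by blast
  then show "w \<in> coset (c * a)" by (simp add: coset_def CT_closed cpair_\<alpha>_simps)
qed

lemma cq_conj_coset: "cq_conj (coset a) = coset (cnj a)"
proof -
  have c: "cconj v \<in> coset (cnj z)" if "v \<in> coset z" for v z
    using that by (simp add: coset_def CT_closed cpair_def d\<rho>_simps J_simps p_U complex_eq_iff)
  show ?thesis
    unfolding cq_conj_def
  proof (intro subset_antisym subsetI)
    fix w assume "w \<in> coset (cnj a)"
    from c[OF this] have "cconj w \<in> coset a" by simp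
    then show "w \<in> cconj ` coset a" by (metis cconj_cconj imageI)
  qed (use c in auto)
qed

lemma cpair_of_mem_coset: "v \<in> coset z \<Longrightarrow> cpair \<alpha> v = z"
  by (simp add: coset_def)

lemma coset_inj: "coset a = coset b \<Longrightarrow> a = b"
  using cpair_of_mem_coset[OF coset_representative[of a]] cpair_of_mem_coset[of "cscale a (e, 0)" b] coset_representative[of a] by simp

lemma cq_pair_coset:
  assumes \<theta>: "contact_form M \<theta>"
  shows "cq_pair (\<theta> p) (coset z) = \<theta> p e * z"
proof -
  have proportional: "\<theta> p u = \<theta> p e * \<alpha> u" if "d\<rho> p u = 0" for u
    using contact_form_proportional[OF \<theta> p that] by (simp add: tan_field_p e)
  have val: "cpair (\<theta> p) v = \<theta> p e * z" if "v \<in> coset z" for v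
  proof -
    have "d\<rho> p (fst v) = 0" "d\<rho> p (snd v) = 0" "cpair \<alpha> v = z"
      using that CT_iff[OF p, of v] by (simp_all add: coset_def)
    then show ?thesis
      using proportional[of "fst v"] proportional[of "snd v"] by (simp add: cpair_def complex_eq_iff)
  qed
  show ?thesis
    unfolding cq_pair_def
  proof (rule the_equality)
    show "\<forall>a\<in>coset z. cpair (\<theta> p) a = \<theta> p e * z" using val by blast
    fix y assume "\<forall>a\<in>coset z. cpair (\<theta> p) a = y"
    then show "y = \<theta> p e * z" using coset_representative[of z] val by metis
  qed
qed

text \<open>The quotient is a complex line, so one contact form that is nonzero at \<open>p\<close> separates its elements.\<close>

lemma CQ_eqI:
  assumes "A \<in> CQ M p" "B \<in> CQ M p" "\<And>\<theta>. contact_form M \<theta> \<Longrightarrow> cq_pair (\<theta> p) A = cq_pair (\<theta> p) B"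
  shows "A = B"
proof -
  obtain a b where "A = coset a" "B = coset b" using assms CQ_eq_range_coset by auto
  moreover obtain \<theta> where "contact_form M \<theta>" "\<theta> p e \<noteq> 0" using contact_form_exists by blast
  ultimately show ?thesis using assms(3)[of \<theta>] by (simp add: cq_pair_coset)
qed

text \<open>Reduces linearity of a map into \<open>CQ\<close> to that of its complex coefficient.\<close>

lemma clinear_on_CQ_coset:
  assumes "\<And>u v a b. u \<in> V \<Longrightarrow> v \<in> V \<Longrightarrow> cscale a u + cscale b v \<in> V \<and>
      F (cscale a u + cscale b v) = a * F u + b * F v"
    and "\<And>v. v \<in> V \<Longrightarrow> f v = coset (c * F v)"
  shows "clinear_on_CQ M p V f"
  unfolding clinear_on_CQ_def using assms
  by (auto simp: cq_plus_coset cq_scale_coset algebra_simps)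

section \<open>The Levi kernel\<close>

definition levi_tensor :: "(complex ^ 'n) cplx \<times> (complex ^ 'n) cplx \<Rightarrow> (complex ^ 'n) cplx set" where
  "levi_tensor = restrict (\<lambda>(v, w). coset (\<i> * levi p v w)) (H10 M p \<times> H10_bar M p)"

lemma is_levi_form_levi_tensor: "is_levi_form M p levi_tensor"
  unfolding is_levi_form_def
proof (intro conjI ballI allI impI)
  show "levi_tensor \<in> H10 M p \<times> H10_bar M p \<rightarrow>\<^sub>E CQ M p"
    by (auto simp: levi_tensor_def CQ_eq_range_coset)
  show "clinear_on_CQ M p (H10 M p) (\<lambda>v. levi_tensor (v, w))" if "w \<in> H10_bar M p" for w
    using that p_U by (intro clinear_on_CQ_coset[where F = "\<lambda>v. levi p v w" and c = \<i>])
      (auto simp: levi_tensor_def H10_subspace[OF p] levi_complex_linear_left)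
  show "clinear_on_CQ M p (H10_bar M p) (\<lambda>w. levi_tensor (v, w))" if "v \<in> H10 M p" for v
    using that p_U by (intro clinear_on_CQ_coset[where F = "\<lambda>w. levi p v w" and c = \<i>])
      (auto simp: levi_tensor_def H10_bar_subspace[OF p] levi_complex_linear_right)
  fix \<theta> L2 L1
  assume "contact_form M \<theta> \<and> local_section M p (H10 M) L2 \<and> local_section M p (H10_bar M) L1"
  then have \<theta>: "contact_form M \<theta>" and L: "local_section M p (H10 M) L2" "local_section M p (H10_bar M) L1"
    by auto
  obtain W where "open W" "p \<in> W"
    "\<And>x. x \<in> M \<inter> W \<Longrightarrow> cpair (\<theta> x) (lie_bracket M L2 L1 x) = contact_ratio \<theta> x * levi x (L2 x) (L1 x)"
    "\<And>x. x \<in> M \<inter> W \<Longrightarrow> L2 x \<in> H10 M x" "\<And>x. x \<in> M \<inter> W \<Longrightarrow> L1 x \<in> H10_bar M x"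
    using contact_bracket[OF \<theta> L] by metis
  then show "cq_pair (\<theta> p) (levi_tensor (L2 p, L1 p)) = \<i> * cpair (\<theta> p) (lie_bracket M L2 L1 p)"
    using p_M by (simp add: levi_tensor_def cq_pair_coset[OF \<theta>] contact_ratio_p)
qed

text \<open>Every pair of vectors is the value at \<open>p\<close> of sections, and contact forms separate the points of \<open>CQ\<close>;
so the defining identity leaves no freedom.\<close>

lemma levi_form_eq: "levi_form M p = levi_tensor"
  unfolding levi_form_def
proof (rule the_equality[where P = "is_levi_form M p", OF is_levi_form_levi_tensor])
  fix \<tau> assume \<tau>: "is_levi_form M p \<tau>"
  have mem: "\<tau> \<in> H10 M p \<times> H10_bar M p \<rightarrow>\<^sub>E CQ M p" "levi_tensor \<in> H10 M p \<times> H10_bar M p \<rightarrow>\<^sub>E CQ M p"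
    using \<tau> is_levi_form_levi_tensor unfolding is_levi_form_def by blast+
  show "\<tau> = levi_tensor"
  proof (rule PiE_ext[OF mem])
    fix x assume x: "x \<in> H10 M p \<times> H10_bar M p"
    obtain v w where [simp]: "x = (v, w)" and v: "v \<in> H10 M p" and w: "w \<in> H10_bar M p" using x by blast
    have S: "local_section M p (H10 M) (hol_lift v)" "local_section M p (H10_bar M) (hol_lift w)"
      using v w by (auto intro: smooth_local_section smooth_hol_lift hol_lift_H10 hol_lift_H10_bar)
    have vw: "hol_lift v p = v" "hol_lift w p = w"
      using v w p by (auto intro!: hol_lift_p simp: H10_iff H10_bar_iff)
    show "\<tau> x = levi_tensor x"
    proof (rule CQ_eqI)
      fix \<theta> assume "contact_form M \<theta>"
      then have "cq_pair (\<theta> p) (\<sigma> (hol_lift v p, hol_lift w p)) = \<i> * cpair (\<theta> p) (lie_bracket M (hol_lift v) (hol_lift w) p)"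
        if "is_levi_form M p \<sigma>" for \<sigma>
        using that S unfolding is_levi_form_def by blast
      from this[OF \<tau>] this[OF is_levi_form_levi_tensor]
      show "cq_pair (\<theta> p) (\<tau> x) = cq_pair (\<theta> p) (levi_tensor x)" by (simp add: vw)
    qed (use mem x in auto)
  qed
qed

lemma cconj_H10_bar: "w \<in> H10_bar M p \<longleftrightarrow> cconj w \<in> H10 M p"
  unfolding H10_bar_def by (metis cconj_cconj image_iff)

lemma K10_iff: "v \<in> K10 M p \<longleftrightarrow> v \<in> H10 M p \<and> (\<forall>u\<in>H10_bar M p. levi p v u = 0)"
proof -
  have "levi_form M p (v, cconj u) = CH M p \<longleftrightarrow> levi p v (cconj u) = 0" if "v \<in> H10 M p" "u \<in> H10 M p" for u
  proof -
    have "levi_form M p (v, cconj u) = coset (\<i> * levi p v (cconj u))"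
      using that by (simp add: levi_form_eq levi_tensor_def cconj_H10_bar)
    then show ?thesis unfolding CH_eq_coset_0 using coset_inj[of "\<i> * levi p v (cconj u)" 0] by auto
  qed
  then show ?thesis unfolding K10_def H10_bar_def by auto
qed

lemma cconj_K10_bar: "w \<in> K10_bar M p \<longleftrightarrow> cconj w \<in> K10 M p"
  unfolding K10_bar_def by (metis cconj_cconj image_iff)

text \<open>By the Hermitian symmetry of the Levi form the kernel in one argument is the conjugate of the kernel
in the other.\<close>

lemma K10_bar_iff: "w \<in> K10_bar M p \<longleftrightarrow> w \<in> H10_bar M p \<and> (\<forall>u\<in>H10 M p. levi p u w = 0)"
proof -
  have "levi p (cconj w) (cconj u) = 0 \<longleftrightarrow> levi p u w = 0" for u
    using levi_cconj[OF p_U, of w u] levi_antisym[of p u w] by simp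
  then have "(\<forall>u\<in>H10_bar M p. levi p (cconj w) u = 0) \<longleftrightarrow> (\<forall>u\<in>H10 M p. levi p u w = 0)"
    unfolding H10_bar_def by simp
  then show ?thesis
    unfolding cconj_K10_bar K10_iff cconj_H10_bar by simp
qed

lemma K10_subspace: "u \<in> K10 M p \<Longrightarrow> v \<in> K10 M p \<Longrightarrow> cscale a u + cscale b v \<in> K10 M p"
  using p_U by (simp add: K10_iff H10_subspace[OF p] levi_complex_linear_left)

lemma K10_bar_subspace: "u \<in> K10_bar M p \<Longrightarrow> v \<in> K10_bar M p \<Longrightarrow> cscale a u + cscale b v \<in> K10_bar M p"
  using p_U by (simp add: K10_bar_iff H10_bar_subspace[OF p] levi_complex_linear_right)

section \<open>The cubic tensor\<close>

definition cubic_tensor ::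
  "(complex ^ 'n) cplx \<times> (complex ^ 'n) cplx \<times> (complex ^ 'n) cplx \<Rightarrow> (complex ^ 'n) cplx set" where
  "cubic_tensor = restrict (\<lambda>(h, v, w). coset (\<i> * cubic h v w)) (CT M p \<times> K10 M p \<times> K10_bar M p)"

lemma is_cubic_tensor_cubic_tensor: "is_cubic_tensor M p cubic_tensor"
  unfolding is_cubic_tensor_def
proof (intro conjI ballI)
  show "cubic_tensor \<in> CT M p \<times> K10 M p \<times> K10_bar M p \<rightarrow>\<^sub>E CQ M p"
    by (auto simp: cubic_tensor_def CQ_eq_range_coset)
  show "clinear_on_CQ M p (CT M p) (\<lambda>h. cubic_tensor (h, v, w))"
    if "v \<in> K10 M p" "w \<in> K10_bar M p" for v w
    using that by (intro clinear_on_CQ_coset[where F = "\<lambda>h. cubic h v w" and c = \<i>])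
      (auto simp: cubic_tensor_def CT_closed cubic_complex_linear)
  show "clinear_on_CQ M p (K10 M p) (\<lambda>v. cubic_tensor (h, v, w))"
    if "h \<in> CT M p" "w \<in> K10_bar M p" for h w
    using that by (intro clinear_on_CQ_coset[where F = "\<lambda>v. cubic h v w" and c = \<i>])
      (auto simp: cubic_tensor_def K10_subspace cubic_complex_linear)
  show "clinear_on_CQ M p (K10_bar M p) (\<lambda>w. cubic_tensor (h, v, w))"
    if "h \<in> CT M p" "v \<in> K10 M p" for h v
    using that by (intro clinear_on_CQ_coset[where F = "\<lambda>w. cubic h v w" and c = \<i>])
      (auto simp: cubic_tensor_def K10_bar_subspace cubic_complex_linear)
qed

lemma local_section_cconj:
  assumes "local_section M p (H10 M) (\<lambda>q. cconj (L q))"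
  shows "local_section M p (H10_bar M) L"
proof -
  obtain W where W: "open W" "p \<in> W" "smooth_map_on (M \<inter> W) (\<lambda>q. cconj (L q))" "\<forall>q\<in>M \<inter> W. cconj (L q) \<in> H10 M q"
    using assms unfolding local_section_def by blast
  have bl: "bounded_linear (cconj :: (complex ^ 'n) cplx \<Rightarrow> _)"
    unfolding cconj_def by (intro bounded_linear_Pair bounded_linear_fst bounded_linear_minus bounded_linear_snd)
  have "smooth_map_on (M \<inter> W) L"
    unfolding smooth_map_on_def
  proof
    fix x assume "x \<in> M \<inter> W"
    then obtain G g where "open G" "x \<in> G" "smooth_on G g" "\<forall>y\<in>M \<inter> W \<inter> G. g y = cconj (L y)"
      using W(3) unfolding smooth_map_on_def by blast
    then show "\<exists>G g. open G \<and> x \<in> G \<and> smooth_on G g \<and> (\<forall>y\<in>M \<inter> W \<inter> G. g y = L y)"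
      by (intro exI[of _ G] exI[of _ "\<lambda>y. cconj (g y)"]) (simp add: smooth_on_bounded_linear[OF _ bl])
  qed
  moreover have "\<forall>q\<in>M \<inter> W. L q \<in> H10_bar M q"
    using W(4) unfolding H10_bar_def by (metis cconj_cconj imageI)
  ultimately show ?thesis using W unfolding local_section_def by blast
qed

text \<open>On \<open>M\<close> near \<open>p\<close> the pairing with the bracket is the contact ratio times the Levi form. The derivative of
the ratio is multiplied by the Levi form at \<open>p\<close>, which vanishes on the kernel; the other term of
the product rule is the cubic form.\<close>

lemma cubic_identity:
  assumes \<theta>: "contact_form M \<theta>" and L3: "L3 \<in> CT M p"
    and L: "local_section M p (H10 M) L2" "local_section M p (H10_bar M) L1"
    and K: "L2 p \<in> K10 M p" "L1 p \<in> K10_bar M p"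
  shows "deriv_fun M L3 (\<lambda>q. cpair (\<theta> q) (lie_bracket M L2 L1 q)) p = \<theta> p e * cubic L3 (L2 p) (L1 p)"
proof -
  let ?F = "\<lambda>q. cpair (\<theta> q) (lie_bracket M L2 L1 q)"
  obtain W where W: "open W" "p \<in> W"
    and F: "\<And>x. x \<in> M \<inter> W \<Longrightarrow> ?F x = contact_ratio \<theta> x * levi x (L2 x) (L1 x)"
    and L2: "\<And>x. x \<in> M \<inter> W \<Longrightarrow> L2 x \<in> H10 M x \<and> L2 differentiable (at x within M)"
    and L1: "\<And>x. x \<in> M \<inter> W \<Longrightarrow> L1 x \<in> H10_bar M x \<and> L1 differentiable (at x within M)"
    using contact_bracket[OF \<theta> L] by metis
  have pW: "p \<in> M \<inter> W" using W p_M by blast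
  obtain L2' where L2': "(L2 has_derivative L2') (at p within M)"
    using L2[OF pW] unfolding differentiable_def by blast
  obtain L1' where L1': "(L1 has_derivative L1') (at p within M)"
    using L1[OF pW] unfolding differentiable_def by blast
  have "\<exists>D. ((\<lambda>x. levi x (L2 x) (L1 x)) has_derivative D) (at p within M) \<and>
    (\<forall>h\<in>tangent_space M p. D h = cubic_real_dir h (L2 p) (L1 p))"
    by (rule levi_along_sections_derivative[OF W _ L2' _ L1'])
       (use L2 L1 K in \<open>auto simp: K10_iff K10_bar_iff\<close>)
  then obtain D where D: "((\<lambda>x. levi x (L2 x) (L1 x)) has_derivative D) (at p within M)"
    "\<And>h. h \<in> tangent_space M p \<Longrightarrow> D h = cubic_real_dir h (L2 p) (L1 p)" by blast
  obtain \<kappa>' where \<kappa>': "(contact_ratio \<theta> has_derivative \<kappa>') (at p within M)"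
    using contact_ratio_differentiable[OF \<theta>] unfolding differentiable_def by blast
  have zero: "levi p (L2 p) (L1 p) = 0"
    using K by (simp add: K10_iff K10_bar_iff)
  have "((\<lambda>x. of_real (contact_ratio \<theta> x) * levi x (L2 x) (L1 x)) has_derivative
      (\<lambda>h. of_real (contact_ratio \<theta> p) * D h + of_real (\<kappa>' h) * levi p (L2 p) (L1 p))) (at p within M)"
    by (intro has_derivative_mult has_derivative_of_real \<kappa>' D)
  then have "(?F has_derivative (\<lambda>h. \<theta> p e * D h)) (at p within M)"
    unfolding zero contact_ratio_p mult_zero_right add_0_right
    by (rule has_derivative_transform_eventually)
       (use W pW F in \<open>auto simp: eventually_at_topological intro!: exI[of _ W]\<close>)
  from tangential_derivative[OF this] D(2) L3
  have "frechet_derivative ?F (at p within M) h = \<theta> p e * cubic_real_dir h (L2 p) (L1 p)"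
    if "h \<in> {fst L3, snd L3}" for h
    using that by (auto simp: CT_def mem_Times_iff)
  then show ?thesis
    by (simp add: deriv_fun_def cubic_def algebra_simps)
qed

lemma satisfies_cubic_identity_cubic_tensor: "satisfies_cubic_identity M p cubic_tensor"
  unfolding satisfies_cubic_identity_def
proof (intro allI impI, elim conjE)
  fix \<theta> L3 L2 L1
  assume \<theta>: "contact_form M \<theta>" and L3: "local_section M p (CT M) L3"
    and L2: "local_section M p (H10 M) L2" and L1: "local_section M p (H10 M) (\<lambda>q. cconj (L1 q))"
    and K: "L2 p \<in> K10 M p" "cconj (L1 p) \<in> K10 M p"
  have T: "L3 p \<in> CT M p" using L3 p_M unfolding local_section_def by blast
  have K': "L1 p \<in> K10_bar M p" using K(2) by (simp add: cconj_K10_bar)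
  show "cq_pair (\<theta> p) (cubic_tensor (L3 p, L2 p, L1 p)) =
      \<i> * deriv_fun M (L3 p) (\<lambda>q. cpair (\<theta> q) (lie_bracket M L2 L1 q)) p"
    using cubic_identity[OF \<theta> T L2 local_section_cconj[OF L1] K(1) K'] T K K'
    by (simp add: cubic_tensor_def cq_pair_coset[OF \<theta>])
qed

text \<open>As for the Levi form: all arguments extend to sections, and contact forms separate values.\<close>

lemma cubic_tensor_unique:
  assumes \<tau>: "is_cubic_tensor M p \<tau>" "satisfies_cubic_identity M p \<tau>"
  shows "\<tau> = cubic_tensor"
proof (rule PiE_ext)
  show mem: "\<tau> \<in> CT M p \<times> K10 M p \<times> K10_bar M p \<rightarrow>\<^sub>E CQ M p"
    "cubic_tensor \<in> CT M p \<times> K10 M p \<times> K10_bar M p \<rightarrow>\<^sub>E CQ M p"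
    using \<tau>(1) is_cubic_tensor_cubic_tensor unfolding is_cubic_tensor_def by blast+
  fix x assume x: "x \<in> CT M p \<times> K10 M p \<times> K10_bar M p"
  obtain h v w where [simp]: "x = (h, v, w)" and hvw: "h \<in> CT M p" "v \<in> K10 M p" "w \<in> K10_bar M p"
    using x by blast
  obtain L3 where L3: "local_section M p (CT M) L3" "L3 p = h"
    using CT_local_section_exists[OF hvw(1)] by blast
  have H: "v \<in> H10 M p" "w \<in> H10_bar M p" "cconj w \<in> H10 M p"
    using hvw by (auto simp: K10_iff K10_bar_iff cconj_H10_bar[symmetric])
  have vw: "hol_lift v p = v" "hol_lift w p = w"
    using H p by (auto intro!: hol_lift_p simp: H10_iff H10_bar_iff)
  have S: "local_section M p (H10 M) (hol_lift v)"
    using H by (auto intro: smooth_local_section smooth_hol_lift hol_lift_H10)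
  have S': "local_section M p (H10 M) (\<lambda>q. cconj (hol_lift w q))"
  proof (rule smooth_local_section)
    show "smooth_on U (\<lambda>q. cconj (hol_lift w q))"
      unfolding cconj_def hol_lift_def
      using smooth_on_bounded_linear[OF open_U bounded_linear_minus[OF bounded_linear_ident]]
      by (auto intro!: smooth_on_Pair smooth_hol_field open_U)
    show "cconj (hol_lift w q) \<in> H10 M q" if "q \<in> M \<inter> U" for q
      using hol_lift_H10[OF H(3) that] that by (simp add: hol_lift_cconj)
  qed
  have K: "hol_lift v p \<in> K10 M p" "cconj (hol_lift w p) \<in> K10 M p"
    using hvw vw by (simp_all add: cconj_K10_bar)
  show "\<tau> x = cubic_tensor x"
  proof (rule CQ_eqI)
    fix \<theta> assume "contact_form M \<theta>"
    then have "cq_pair (\<theta> p) (\<sigma> (L3 p, hol_lift v p, hol_lift w p)) =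
        \<i> * deriv_fun M (L3 p) (\<lambda>q. cpair (\<theta> q) (lie_bracket M (hol_lift v) (hol_lift w) q)) p"
      if "satisfies_cubic_identity M p \<sigma>" for \<sigma>
      using that[unfolded satisfies_cubic_identity_def, rule_format, of \<theta> L3 "hol_lift v" "hol_lift w"]
        L3(1) S S' K by blast
    from this[OF \<tau>(2)] this[OF satisfies_cubic_identity_cubic_tensor]
    show "cq_pair (\<theta> p) (\<tau> x) = cq_pair (\<theta> p) (cubic_tensor x)" by (simp add: vw L3)
  qed (use mem x in auto)
qed

lemma cubic_tensor_reality:
  assumes "h \<in> CT M p" "v \<in> K10 M p" "w \<in> K10_bar M p"
  shows "cq_conj (cubic_tensor (h, v, w)) = cubic_tensor (cconj h, cconj w, cconj v)"
  using assms by (simp add: cubic_tensor_def cq_conj_coset cubic_cconj CT_closed cconj_K10_bar)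

end

theorem lemma3p4:
  fixes M :: "(complex ^ 'n) set" and p :: "complex ^ 'n"
  assumes "smooth_real_hypersurface M" and "p \<in> M"
  shows "(\<exists>!\<tau>. is_cubic_tensor M p \<tau> \<and> satisfies_cubic_identity M p \<tau>) \<and>
         (\<forall>\<tau>. is_cubic_tensor M p \<tau> \<and> satisfies_cubic_identity M p \<tau> \<longrightarrow>
            (\<forall>v3\<in>CT M p. \<forall>v2\<in>K10 M p. \<forall>v1\<in>K10_bar M p.
               cq_conj (\<tau> (v3, v2, v1)) = \<tau> (cconj v3, cconj v1, cconj v2)))"
proof -
  obtain U and \<rho> :: "complex ^ 'n \<Rightarrow> real" where U: "open U" "p \<in> U" "smooth_on U \<rho>"
    "M \<inter> U = {x \<in> U. \<rho> x = 0}" "\<forall>x\<in>M \<inter> U. \<exists>v. frechet_derivative \<rho> (at x) v \<noteq> 0"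
    using assms unfolding smooth_real_hypersurface_def by blast
  interpret chart: hypersurface_chart M U \<rho>
    by standard (use U in auto)
  have p: "p \<in> M \<inter> U" using assms U by blast
  obtain e where "chart.d\<rho> p e = 0" "chart.d\<rho> p (J e) = 1"
    using chart.transversal_exists[OF p] by blast
  then interpret hypersurface_point M U \<rho> p e
    by unfold_locales (use p in auto)
  show ?thesis
    using is_cubic_tensor_cubic_tensor satisfies_cubic_identity_cubic_tensor
      cubic_tensor_unique cubic_tensor_reality by metis
qed

end
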